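(* Let $d,n\in\mathbb{N}_{\ge1}$, $\beta\in(0,1]$ and $I=[0,1]$. The flow map $$L^1(I,C^{n,\beta}_0(\mathbb{R}^d,\mathbb{R}^d))\to C(I,\mathcal{D}^{n,\beta}(\mathbb{R}^d)),\quad u\mapsto\Phi,$$ is bounded (i.e. it maps bounded sets to bounded sets).
   Context: $C^{n,\beta}_0(\mathbb{R}^d,\mathbb{R}^d)$ is the Banach space of $C^n$-maps $f:\mathbb{R}^d\to\mathbb{R}^d$ with $f^{(l)}(x)\to0$ as $\|x\|\to\infty$ for $0\le l\le n$ and $\|f\|_{n,\beta}:=\max\{\sup_{x,\,0\le l\le n}\|f^{(l)}(x)\|,\ \sup_{x\ne y}\|f^{(n)}(x)-f^{(n)}(y)\|/\|x-y\|^\beta\}<\infty$. $\mathcal{D}^{n,\beta}(\mathbb{R}^d):=\{\Phi\in\mathrm{Id}+C^{n,\beta}_0(\mathbb{R}^d,\mathbb{R}^d):\det d\Phi(x)>0\ \forall x\}$ with metric $\|\Phi_1-\Phi_2\|_{n,\beta}$. $L^1(I,C^{n,\beta}_0(\mathbb{R}^d,\mathbb{R}^d))$ is the Banach space of (classes of) Bochner integrable functions, with norm $\int_0^1\|u(t)\|_{n,\beta}\,dt$. Each such $u$ has a unique pointwise flow $\Phi:I\times\mathbb{R}^d\to\mathbb{R}^d$, $\Phi(t,x)=x+\int_0^tu(s)(\Phi(s,x))\,ds$, and $t\mapsto\Phi(t,\cdot)$ is a continuous map $I\to\mathcal{D}^{n,\beta}(\mathbb{R}^d)$; the flow map sends $u$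 to this map. $C(I,\mathcal{D}^{n,\beta}(\mathbb{R}^d))$ is identified, via $\Phi\mapsto\Phi-\mathrm{Id}$, with a subset of $C(I,C^{n,\beta}_0(\mathbb{R}^d,\mathbb{R}^d))$, normed by $\sup_{t\in I}\|\cdot\|_{n,\beta}$. *)

theory Defs
  imports "HOL-Analysis.Analysis"
begin

text \<open>The \<open>l\<close>-th Frechet derivative \<open>f\<^sup>(\<^sup>l\<^sup>)(x)\<close> is an \<open>l\<close>-linear map. It is represented by its
  values on lists of \<open>l\<close> vectors:
  \<open>iter_deriv f [v\<^sub>1, \<dots>, v\<^sub>l] x = f\<^sup>(\<^sup>l\<^sup>)(x)(v\<^sub>1, \<dots>, v\<^sub>l)\<close>.\<close>

fun iter_deriv :: "('a::real_normed_vector \<Rightarrow> 'b::real_normed_vector) \<Rightarrow> 'a list \<Rightarrow> 'a \<Rightarrow> 'b" where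
  "iter_deriv f [] x = f x"
| "iter_deriv f (v # vs) x = frechet_derivative (iter_deriv f vs) (at x) v"

definition multi_onorm :: "nat \<Rightarrow> ('a::real_normed_vector list \<Rightarrow> 'b::real_normed_vector) \<Rightarrow> ennreal" where
  "multi_onorm l T = (SUP vs\<in>{vs. length vs = l \<and> (\<forall>v\<in>set vs. norm v \<le> 1)}. ennreal (norm (T vs)))"

text \<open>The domain is finite-dimensional, so differentiability and continuity of \<open>f\<^sup>(\<^sup>l\<^sup>)\<close> as a map into
  the space of \<open>l\<close>-linear maps amount to those of all its evaluations.\<close>

definition Cn_map :: "nat \<Rightarrow> ('a::euclidean_space \<Rightarrow> 'b::real_normed_vector) \<Rightarrow> bool" where
  "Cn_map n f \<longleftrightarrow>
     (\<forall>vs x. length vs < n \<longrightarrow> iter_deriv f vs differentiable at x) \<and>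
     (\<forall>vs. length vs \<le> n \<longrightarrow> continuous_on UNIV (iter_deriv f vs))"

definition holder_norm :: "nat \<Rightarrow> real \<Rightarrow> ('a::euclidean_space \<Rightarrow> 'b::real_normed_vector) \<Rightarrow> ennreal" where
  "holder_norm n \<beta> f = max
     (SUP (x, l)\<in>UNIV \<times> {..n}. multi_onorm l (\<lambda>vs. iter_deriv f vs x))
     (SUP (x, y)\<in>{(x, y). x \<noteq> y}.
        multi_onorm n (\<lambda>vs. iter_deriv f vs x - iter_deriv f vs y) / ennreal (norm (x - y) powr \<beta>))"

definition C0_holder :: "nat \<Rightarrow> real \<Rightarrow> ('a::euclidean_space \<Rightarrow> 'a) set" where
  "C0_holder n \<beta> = {f. Cn_map n f \<and>
     (\<forall>l\<le>n. ((\<lambda>x. multi_onorm l (\<lambda>vs. iter_deriv f vs x)) \<longlongrightarrow> 0) at_infinity) \<and>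
     holder_norm n \<beta> f < \<infinity>}"

definition diffeo_holder :: "nat \<Rightarrow> real \<Rightarrow> (real^'d \<Rightarrow> real^'d) set" where
  "diffeo_holder n \<beta> = {\<Phi>. (\<lambda>x. \<Phi> x - x) \<in> C0_holder n \<beta> \<and> (\<forall>x. det (jacobian \<Phi> (at x)) > 0)}"

text \<open>The library's Bochner integral requires a second-countable (hence separable) target type.
  The space \<open>C0_holder n \<beta>\<close> is not separable and depends on the parameters \<open>n\<close> and \<open>\<beta>\<close>, so strong
  measurability and Bochner integrability on \<open>[0,1]\<close> are spelled out. Elements of \<open>L\<^sup>1\<close> are
  represented by functions instead of classes modulo null sets.\<close>

definition simple_C0_holder :: "nat \<Rightarrow> real \<Rightarrow> (real \<Rightarrow> 'a::euclidean_space \<Rightarrow> 'a) \<Rightarrow> bool" where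
  "simple_C0_holder n \<beta> s \<longleftrightarrow>
     simple_function (lebesgue_on {0..1}) s \<and> (\<forall>t\<in>{0..1}. s t \<in> C0_holder n \<beta>)"

definition strongly_measurable_C0_holder :: "nat \<Rightarrow> real \<Rightarrow> (real \<Rightarrow> 'a::euclidean_space \<Rightarrow> 'a) \<Rightarrow> bool" where
  "strongly_measurable_C0_holder n \<beta> u \<longleftrightarrow>
     (\<forall>t\<in>{0..1}. u t \<in> C0_holder n \<beta>) \<and>
     (\<exists>s. (\<forall>k::nat. simple_C0_holder n \<beta> (s k)) \<and>
       (AE t in lebesgue_on {0..1}. (\<lambda>k. holder_norm n \<beta> (\<lambda>x. u t x - s k t x)) \<longlonglongrightarrow> 0))"

definition L1_C0_holder :: "nat \<Rightarrow> real \<Rightarrow> (real \<Rightarrow> 'a::euclidean_space \<Rightarrow> 'a) set" where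
  "L1_C0_holder n \<beta> = {u. strongly_measurable_C0_holder n \<beta> u \<and>
     (\<exists>s. (\<forall>k::nat. simple_C0_holder n \<beta> (s k)) \<and>
       (\<lambda>k. \<integral>\<^sup>+t. holder_norm n \<beta> (\<lambda>x. u t x - s k t x) \<partial>lebesgue_on {0..1}) \<longlonglongrightarrow> 0)}"

definition L1_norm :: "nat \<Rightarrow> real \<Rightarrow> (real \<Rightarrow> 'a::euclidean_space \<Rightarrow> 'a) \<Rightarrow> ennreal" where
  "L1_norm n \<beta> u = (\<integral>\<^sup>+t. holder_norm n \<beta> (u t) \<partial>lebesgue_on {0..1})"

text \<open>Curves on \<open>[0,1]\<close> are functions on \<open>real\<close>; being \<open>extensional\<close> fixes their values
  outside of \<open>[0,1]\<close>, which makes the flow unique.\<close>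

definition C_diffeo_holder :: "nat \<Rightarrow> real \<Rightarrow> (real \<Rightarrow> real^'d \<Rightarrow> real^'d) set" where
  "C_diffeo_holder n \<beta> = {\<Phi> \<in> extensional {0..1}. (\<forall>t\<in>{0..1}. \<Phi> t \<in> diffeo_holder n \<beta>) \<and>
     (\<forall>t\<in>{0..1}. ((\<lambda>s. holder_norm n \<beta> (\<lambda>x. \<Phi> s x - \<Phi> t x)) \<longlongrightarrow> 0) (at t within {0..1}))}"

definition sup_norm_minus_id :: "nat \<Rightarrow> real \<Rightarrow> (real \<Rightarrow> real^'d \<Rightarrow> real^'d) \<Rightarrow> ennreal" where
  "sup_norm_minus_id n \<beta> \<Phi> = (SUP t\<in>{0..1}. holder_norm n \<beta> (\<lambda>x. \<Phi> t x - x))"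

definition is_flow :: "(real \<Rightarrow> 'a::euclidean_space \<Rightarrow> 'a) \<Rightarrow> (real \<Rightarrow> 'a \<Rightarrow> 'a) \<Rightarrow> bool" where
  "is_flow u \<Phi> \<longleftrightarrow> \<Phi> \<in> extensional {0..1} \<and>
     (\<forall>x. set_integrable lebesgue {0..1} (\<lambda>s. u s (\<Phi> s x)) \<and>
       (\<forall>t\<in>{0..1}. \<Phi> t x = x + (LINT s:{0..t}|lebesgue. u s (\<Phi> s x))))"

definition flow_map :: "(real \<Rightarrow> 'a::euclidean_space \<Rightarrow> 'a) \<Rightarrow> (real \<Rightarrow> 'a \<Rightarrow> 'a)" where
  "flow_map u = (THE \<Phi>. is_flow u \<Phi>)"

definition bounded_L1 :: "nat \<Rightarrow> real \<Rightarrow> (real \<Rightarrow> 'a::euclidean_space \<Rightarrow> 'a) set \<Rightarrow> bool" where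
  "bounded_L1 n \<beta> B \<longleftrightarrow> B \<subseteq> L1_C0_holder n \<beta> \<and> (\<exists>R::real. \<forall>u\<in>B. L1_norm n \<beta> u \<le> ennreal R)"

definition bounded_C_diffeo :: "nat \<Rightarrow> real \<Rightarrow> (real \<Rightarrow> real^'d \<Rightarrow> real^'d) set \<Rightarrow> bool" where
  "bounded_C_diffeo n \<beta> S \<longleftrightarrow>
     S \<subseteq> C_diffeo_holder n \<beta> \<and> (\<exists>R::real. \<forall>\<Phi>\<in>S. sup_norm_minus_id n \<beta> \<Phi> \<le> ennreal R)"

end

theory Submission
  imports Defs
begin

text \<open>Composition obeys \<open>\<parallel>f \<circ> \<Phi>\<parallel> \<le> C(K) \<parallel>f\<parallel>\<close> whenever \<open>\<parallel>\<Phi> - Id\<parallel> \<le> K\<close>, all norms being those of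
  \<open>C\<^sup>n\<^sup>,\<^sup>\<beta>\<close>. Hence, if \<open>\<integral>\<parallel>u\<parallel>\<close> is smaller than some \<open>\<epsilon>\<close> that depends only on \<open>n\<close>, \<open>\<beta>\<close> and the dimension,
  the Picard iterates stay in the ball of radius \<open>1/2\<close> around \<open>Id\<close>; they converge
  uniformly, and the ball is closed under pointwise limits, because a Hoelder bound on the derivative
  amounts to a uniform bound on the Taylor remainder. The Jacobian determinant is positive in this
  ball. For \<open>\<integral>\<parallel>u\<parallel> \<le> R\<close>, cut \<open>[0,1]\<close> into about \<open>R/\<epsilon>\<close> intervals of mass at most \<open>\<epsilon>\<close>: the flow is a
  composition of that many maps in the ball, so its norm is bounded in terms of \<open>R\<close> alone.
  Continuity in time follows from \<open>\<parallel>\<Phi>\<^sub>t - \<Phi>\<^sub>s\<parallel> \<le> C \<integral>\<^sub>s\<^sup>t \<parallel>u\<parallel>\<close>.\<close>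

section \<open>Hoelder bounds on iterated derivatives\<close>

text \<open>The obstacle is a loss of derivatives: the difference of u \<circ> \<Phi> and u \<circ>
  \<Psi> is not controlled in the full norm by the difference of \<Phi> and \<Psi>, so Picard
  iteration need not contract in that norm. It contracts in the sup norm, where n \<ge> 1 supplies a
  Lipschitz constant; the full norm is merely kept bounded, and this bound has to survive a limit
  that carries no information on derivatives. This shapes \<open>holder_bound\<close>:
  differentiating once in a fixed direction and asking the same of the result turns each closure
  property (sum, product, composition, limit, integral) into an induction that handles one ordinary
  derivative per step, without multilinear maps or a formula for higher derivatives of a
  composition. Constant factors may be lost freely, except under limits, where the Picard ball must
  not grow.\<close>

primrec holder_bound ::
  "real \<Rightarrow> nat \<Rightarrow> real \<Rightarrow> ('a::euclidean_space \<Rightarrow> 'b::real_normed_vector) \<Rightarrow> bool" where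
  "holder_bound \<beta> 0 M f \<longleftrightarrow>
     (\<forall>x. norm (f x) \<le> M) \<and> (\<forall>x y. norm (f x - f y) \<le> M * norm (x - y) powr \<beta>)"
| "holder_bound \<beta> (Suc n) M f \<longleftrightarrow>
     (\<forall>x. norm (f x) \<le> M) \<and> (\<forall>x. f differentiable at x) \<and>
     (\<forall>v. norm v \<le> 1 \<longrightarrow> holder_bound \<beta> n M (\<lambda>x. frechet_derivative f (at x) v))"

lemma holder_bound_norm: "holder_bound \<beta> n M f \<Longrightarrow> norm (f x) \<le> M"
  by (cases n) auto

lemma holder_bound_nonneg: "holder_bound \<beta> n M f \<Longrightarrow> 0 \<le> M"
  using holder_bound_norm norm_ge_zero order_trans by blast

lemma holder_bound_has_derivative:
  "holder_bound \<beta> (Suc n) M f \<Longrightarrow> (f has_derivative frechet_derivative f (at x)) (at x)"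
  by (simp add: frechet_derivative_works)

lemma holder_bound_SucI:
  assumes "\<And>x. norm (f x) \<le> M"
    and "\<And>x. (f has_derivative F x) (at x)"
    and "\<And>v. norm v \<le> 1 \<Longrightarrow> holder_bound \<beta> n M (\<lambda>x. F x v)"
  shows "holder_bound \<beta> (Suc n) M f"
proof -
  have "F x = frechet_derivative f (at x)" for x
    using assms(2) frechet_derivative_at by blast
  then show ?thesis
    using assms by (auto simp: differentiable_def)
qed

lemma holder_bound_frechet_derivative_unit:
  "holder_bound \<beta> (Suc n) M f \<Longrightarrow> norm v \<le> 1 \<Longrightarrow>
    holder_bound \<beta> n M (\<lambda>x. frechet_derivative f (at x) v)"
  by simp

lemma holder_bound_mono: "holder_bound \<beta> n M f \<Longrightarrow> M \<le> M' \<Longrightarrow> holder_bound \<beta> n M' f"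
proof (induction n arbitrary: f)
  case 0
  have "M * norm (x - y) powr \<beta> \<le> M' * norm (x - y) powr \<beta>" for x y :: 'a
    using 0(2) by (intro mult_right_mono) auto
  with 0 show ?case
    unfolding holder_bound.simps by (meson order_trans)
next
  case (Suc n)
  then show ?case
    by (auto intro: order_trans)
qed

lemma holder_bound_const: "holder_bound \<beta> n (norm c) (\<lambda>x. c)"
proof -
  have z: "holder_bound \<beta> n 0 (\<lambda>x. 0)" for n
    by (induction n) (auto simp: frechet_derivative_const)
  show ?thesis
  proof (cases n)
    case (Suc m)
    then show ?thesis
      using holder_bound_mono[OF z[of m], of "norm c"] by (auto simp: frechet_derivative_const)
  qed auto
qed

lemma holder_bound_bounded_linear:
  assumes A: "bounded_linear A" "\<And>y. norm (A y) \<le> C * norm y" and C: "0 \<le> C"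
  shows "holder_bound \<beta> n M f \<Longrightarrow> holder_bound \<beta> n (C * M) (\<lambda>x. A (f x))"
proof (induction n arbitrary: f)
  case 0
  interpret A: bounded_linear A by fact
  show ?case
    using 0 C by (auto simp: A.diff[symmetric] mult.assoc intro!: order_trans[OF A(2)] mult_left_mono)
next
  case (Suc n)
  show ?case
  proof (rule holder_bound_SucI)
    show "norm (A (f x)) \<le> C * M" for x
      using A(2)[of "f x"] holder_bound_norm[OF Suc.prems, of x] C
      by (meson mult_left_mono order_trans)
    show "((\<lambda>x. A (f x)) has_derivative (\<lambda>v. A (frechet_derivative f (at x) v))) (at x)" for x
      using A(1) holder_bound_has_derivative[OF Suc.prems] by (rule bounded_linear.has_derivative)
    show "holder_bound \<beta> n (C * M) (\<lambda>x. A (frechet_derivative f (at x) v))" if "norm v \<le> 1" for v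
      using Suc that by simp
  qed
qed

lemma holder_bound_scaleR:
  "holder_bound \<beta> n M f \<Longrightarrow> holder_bound \<beta> n (\<bar>c\<bar> * M) (\<lambda>x. c *\<^sub>R f x)"
  by (rule holder_bound_bounded_linear[OF bounded_linear_scaleR_right]) auto

lemma holder_bound_uminus:
  "holder_bound \<beta> n M f \<Longrightarrow> holder_bound \<beta> n M (\<lambda>x. - f x)"
  using holder_bound_scaleR[of \<beta> n M f "-1"] by simp

lemma holder_bound_inner:
  "holder_bound \<beta> n M f \<Longrightarrow> norm b \<le> 1 \<Longrightarrow> holder_bound \<beta> n M (\<lambda>x. f x \<bullet> b)"
  using holder_bound_bounded_linear[OF bounded_linear_inner_left[of b], of 1 \<beta> n M f]
    order_trans[OF Cauchy_Schwarz_ineq2] mult_left_mono[of "norm b" 1 "norm y" for y]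
  by (metis mult_1 mult.right_neutral norm_ge_zero real_norm_def zero_le_one)

lemma holder_bound_add:
  "holder_bound \<beta> n M f \<Longrightarrow> holder_bound \<beta> n K g \<Longrightarrow> holder_bound \<beta> n (M + K) (\<lambda>x. f x + g x)"
proof (induction n arbitrary: f g)
  case 0
  show ?case
    unfolding holder_bound.simps
  proof (intro conjI allI)
    show "norm (f x + g x) \<le> M + K" for x
      using 0 by (auto intro: norm_triangle_mono)
    show "norm (f x + g x - (f y + g y)) \<le> (M + K) * norm (x - y) powr \<beta>" for x y
      using 0 norm_triangle_mono[of "f x - f y" "M * norm (x - y) powr \<beta>" "g x - g y" "K * norm (x - y) powr \<beta>"]
      by (simp add: algebra_simps)
  qed
next
  case (Suc n)
  show ?case
  proof (rule holder_bound_SucI)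
    show "norm (f x + g x) \<le> M + K" for x
      using Suc.prems by (auto intro: norm_triangle_mono)
    show "((\<lambda>x. f x + g x) has_derivative
        (\<lambda>v. frechet_derivative f (at x) v + frechet_derivative g (at x) v)) (at x)" for x
      using Suc.prems by (intro has_derivative_add holder_bound_has_derivative)
    show "holder_bound \<beta> n (M + K)
        (\<lambda>x. frechet_derivative f (at x) v + frechet_derivative g (at x) v)" if "norm v \<le> 1" for v
      using Suc that by simp
  qed
qed

lemma holder_bound_diff:
  "holder_bound \<beta> n M f \<Longrightarrow> holder_bound \<beta> n K g \<Longrightarrow> holder_bound \<beta> n (M + K) (\<lambda>x. f x - g x)"
  using holder_bound_add[of \<beta> n M f K "\<lambda>x. - g x"] holder_bound_uminus[of \<beta> n K g] by simp

lemma holder_bound_sum: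
  assumes "finite I" "\<And>i. i \<in> I \<Longrightarrow> holder_bound \<beta> n M (f i)"
  shows "holder_bound \<beta> n (real (card I) * M) (\<lambda>x. \<Sum>i\<in>I. f i x)"
  using assms
proof (induction I rule: finite_induct)
  case empty
  then show ?case using holder_bound_const[of \<beta> n 0] by simp
next
  case (insert i I)
  have "holder_bound \<beta> n (M + real (card I) * M) (\<lambda>x. f i x + (\<Sum>i\<in>I. f i x))"
    using insert by (intro holder_bound_add) auto
  with insert show ?case by (simp add: algebra_simps)
qed

text \<open>The definition speaks only of directions of norm at most 1; linearity of the derivative
  rescales any other direction.\<close>

lemma holder_bound_frechet_derivative:
  assumes "holder_bound \<beta> (Suc n) M f"
  shows "holder_bound \<beta> n (norm v * M) (\<lambda>x. frechet_derivative f (at x) v)"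
proof -
  have "frechet_derivative f (at x) v = norm v *\<^sub>R frechet_derivative f (at x) (v /\<^sub>R norm v)" for x
    using linear_frechet_derivative[of f "at x"] assms by (cases "v = 0") (simp_all add: linear_scale linear_0)
  \<comment> \<open>For v = 0 the division by zero yields the zero vector, which still has norm at
    most 1.\<close>
  moreover have "holder_bound \<beta> n M (\<lambda>x. frechet_derivative f (at x) (v /\<^sub>R norm v))"
    using assms by (intro holder_bound_frechet_derivative_unit) (auto simp: divide_simps)
  ultimately show ?thesis
    using holder_bound_scaleR[of \<beta> n M _ "norm v"] by (simp del: scaleR_scaleR)
qed

lemma holder_bound_norm_frechet_derivative:
  "holder_bound \<beta> (Suc n) M f \<Longrightarrow> norm (frechet_derivative f (at x) v) \<le> M * norm v"
  using holder_bound_norm[OF holder_bound_frechet_derivative[of \<beta> n M f v]]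
  by (simp add: mult.commute)

lemma holder_bound_Lipschitz:
  assumes f: "holder_bound \<beta> n M f" and n: "n \<ge> 1"
  shows "norm (f x - f y) \<le> M * norm (x - y)"
proof -
  obtain m where m: "n = Suc m" using n by (cases n) auto
  have "norm (f x - f y) \<le> M * norm (x - y)"
  proof (rule differentiable_bound[where S = UNIV])
    show "(f has_derivative frechet_derivative f (at z)) (at z within UNIV)" for z
      using holder_bound_has_derivative[of \<beta> m M f z] f m by simp
    show "onorm (frechet_derivative f (at z)) \<le> M" for z
      using holder_bound_norm_frechet_derivative[of \<beta> m M f z] f m by (intro onorm_le) auto
  qed auto
  then show ?thesis .
qed

section \<open>Lowering the order, products and compositions\<close>

locale holder_exponent =
  fixes \<beta> :: real
  assumes \<beta>: "0 < \<beta>" "\<beta> \<le> 1"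
begin

text \<open>The factor 2 is for long distances: if |x - y| \<le> 1, the Lipschitz bound suffices,
  since \<beta> \<le> 1 gives r \<le> r^\<beta>; beyond that, |f x - f y| \<le> 2 M. Lowering the
  order of differentiability therefore costs a factor 2, which feeds the constants of the product
  and composition estimates.\<close>

lemma holder_bound_Holder:
  assumes f: "holder_bound \<beta> n M f"
  shows "norm (f x - f y) \<le> 2 * M * norm (x - y) powr \<beta>"
proof (cases n)
  case 0
  have "M * norm (x - y) powr \<beta> \<le> 2 * M * norm (x - y) powr \<beta>"
    using holder_bound_nonneg[OF f] by (intro mult_right_mono) auto
  moreover have "norm (f x - f y) \<le> M * norm (x - y) powr \<beta>"
    using f 0 by simp
  ultimately show ?thesis by linarith
next
  case (Suc m)
  have M: "0 \<le> M" using holder_bound_nonneg[OF f] .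
  show ?thesis
  proof (cases "norm (x - y) \<le> 1")
    case True
    have "norm (x - y) \<le> norm (x - y) powr \<beta>"
      using \<beta> True powr_mono'[of \<beta> 1 "norm (x - y)"] by (cases "x = y") auto
    then have "M * norm (x - y) \<le> M * norm (x - y) powr \<beta>"
      using M by (rule mult_left_mono)
    also have "\<dots> \<le> 2 * M * norm (x - y) powr \<beta>"
      using M by (intro mult_right_mono) auto
    finally show ?thesis
      using holder_bound_Lipschitz[OF f, of x y] Suc by simp
  next
    case False
    have "norm (f x - f y) \<le> 2 * M"
      using norm_triangle_ineq4[of "f x" "f y"] holder_bound_norm[OF f, of x]
        holder_bound_norm[OF f, of y] by simp
    also have "\<dots> \<le> 2 * M * norm (x - y) powr \<beta>"
      using ge_one_powr_ge_zero[of "norm (x - y)" \<beta>] False \<beta> M mult_left_mono[of 1 _ "2 * M"] by simp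
    finally show ?thesis .
  qed
qed

lemma holder_bound_continuous:
  assumes f: "holder_bound \<beta> n M f"
  shows "continuous_on UNIV f"
proof -
  have "(f \<longlongrightarrow> f x) (at x)" for x
  proof (rule Lim_transform_bound[where g = "\<lambda>y. 2 * M * norm (y - x) powr \<beta>", THEN LIM_zero_cancel])
    show "\<forall>\<^sub>F y in at x. norm (f y - f x) \<le> norm (2 * M * norm (y - x) powr \<beta>)"
      using holder_bound_Holder[OF f] holder_bound_nonneg[OF f] by (auto simp: abs_mult)
    have "((\<lambda>y. norm (y - x) powr \<beta>) \<longlongrightarrow> 0 powr \<beta>) (at x)"
      using \<beta> by (intro tendsto_powr' tendsto_eq_intros) (auto intro!: tendsto_eq_intros)
    then show "((\<lambda>y. 2 * M * norm (y - x) powr \<beta>) \<longlongrightarrow> 0) (at x)"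
      by (auto intro: tendsto_mult_right_zero)
  qed
  then show ?thesis
    by (simp add: continuous_on_eq_continuous_at isCont_def)
qed

lemma holder_bound_Suc_imp: "holder_bound \<beta> (Suc n) M f \<Longrightarrow> holder_bound \<beta> n (2 * M) f"
proof (induction n arbitrary: f)
  case 0
  have "norm (f x) \<le> 2 * M" for x
    using holder_bound_norm[OF 0, of x] holder_bound_nonneg[OF 0] by simp
  then show ?case
    using holder_bound_Holder[OF 0] by simp
next
  case (Suc n)
  have "norm (f x) \<le> 2 * M" for x
    using holder_bound_norm[OF Suc.prems, of x] holder_bound_nonneg[OF Suc.prems] by simp
  then show ?case
    using Suc by simp
qed

text \<open>Each differentiation splits the product into two terms, and in each of them one factor
  has to be lowered by an order at the cost of a factor 2. So the constants obey c_(n+1) = 2 c_n + 2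
  c_n with c_0 = 2.\<close>

lemma holder_bound_mult:
  fixes g :: "'a::euclidean_space \<Rightarrow> real" and f :: "'a \<Rightarrow> 'b::real_normed_vector"
  shows "holder_bound \<beta> n M g \<Longrightarrow> holder_bound \<beta> n K f \<Longrightarrow>
    holder_bound \<beta> n (2 * 4 ^ n * M * K) (\<lambda>x. g x *\<^sub>R f x)"
proof (induction n arbitrary: f g M K)
  case 0
  note MK = holder_bound_nonneg[OF 0(1)] holder_bound_nonneg[OF 0(2)]
  have b: "norm (g x *\<^sub>R f x) \<le> M * K" for x
    using 0 MK by (auto intro!: mult_mono)
  have "norm (g x *\<^sub>R f x - g y *\<^sub>R f y) \<le> 2 * M * K * norm (x - y) powr \<beta>" for x y
  proof -
    have "g x *\<^sub>R f x - g y *\<^sub>R f y = g x *\<^sub>R (f x - f y) + (g x - g y) *\<^sub>R f y"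
      by (simp add: algebra_simps)
    also have "norm \<dots> \<le> norm (g x) * norm (f x - f y) + norm (g x - g y) * norm (f y)"
      by (rule norm_triangle_mono) auto
    also have "\<dots> \<le> M * (K * norm (x - y) powr \<beta>) + (M * norm (x - y) powr \<beta>) * K"
      using 0 MK by (intro add_mono mult_mono) auto
    finally show ?thesis by (simp add: algebra_simps)
  qed
  moreover have "norm (g x *\<^sub>R f x) \<le> 2 * M * K" for x
    using b[of x] MK mult_nonneg_nonneg[of M K] by linarith
  ultimately show ?case
    by simp
next
  case (Suc n)
  note MK = holder_bound_nonneg[OF Suc.prems(1)] holder_bound_nonneg[OF Suc.prems(2)]
  have *: "2 * 4 ^ Suc n * M * K = 2 * 4 ^ n * (2 * M) * K + 2 * 4 ^ n * M * (2 * K)"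
    by simp
  show ?case
  proof (rule holder_bound_SucI)
    have "norm (g x *\<^sub>R f x) \<le> M * K" for x
      using MK holder_bound_norm[OF Suc.prems(1), of x] holder_bound_norm[OF Suc.prems(2), of x]
      by (auto intro!: mult_mono)
    moreover have "1 * (M * K) \<le> (2 * 4 ^ Suc n) * (M * K)"
      using MK one_le_power[of "4::real" n] by (intro mult_right_mono) (auto simp del: one_le_power)
    ultimately show "norm (g x *\<^sub>R f x) \<le> 2 * 4 ^ Suc n * M * K" for x
      by (metis mult.assoc mult_1 order_trans)
    show "((\<lambda>x. g x *\<^sub>R f x) has_derivative
        (\<lambda>v. g x *\<^sub>R frechet_derivative f (at x) v + frechet_derivative g (at x) v *\<^sub>R f x)) (at x)" for x
      using Suc.prems by (intro has_derivative_scaleR holder_bound_has_derivative)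
    show "holder_bound \<beta> n (2 * 4 ^ Suc n * M * K)
        (\<lambda>x. g x *\<^sub>R frechet_derivative f (at x) v + frechet_derivative g (at x) v *\<^sub>R f x)"
      if "norm v \<le> 1" for v
      unfolding * using Suc.prems that
      by (intro holder_bound_add Suc.IH holder_bound_frechet_derivative_unit holder_bound_Suc_imp)
  qed
qed

text \<open>The chain rule reduces f \<circ> \<Phi> to Df \<circ> \<Phi>, one order lower. Lowering
  \<Phi> - Id doubles K, so the induction runs over all K. The Lipschitz constant L is a separate
  hypothesis that stays fixed: the base case needs it to transfer the Hoelder quotient, and a bound
  of order 0 on \<Phi> - Id would not give it. The difference \<Phi> - Id is used because \<Phi>
  itself is unbounded.\<close>

lemma holder_bound_compose:
  assumes K: "0 \<le> K" and L: "1 \<le> L"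
  shows "\<exists>C\<ge>1. \<forall>M (f::'a::euclidean_space \<Rightarrow> 'b::real_normed_vector) \<Phi>.
    holder_bound \<beta> n M f \<longrightarrow> holder_bound \<beta> n K (\<lambda>x. \<Phi> x - x) \<longrightarrow>
    (\<forall>x y. norm (\<Phi> x - \<Phi> y) \<le> L * norm (x - y)) \<longrightarrow> holder_bound \<beta> n (C * M) (\<lambda>x. f (\<Phi> x))"
  using K
proof (induction n arbitrary: K)
  case 0
  have "holder_bound \<beta> 0 (L powr \<beta> * M) (\<lambda>x. f (\<Phi> x))"
    if f: "holder_bound \<beta> 0 M f" and lip: "\<And>x y. norm (\<Phi> x - \<Phi> y) \<le> L * norm (x - y)"
    for M and f :: "'a \<Rightarrow> 'b" and \<Phi>
  proof -
    have M: "0 \<le> M" using holder_bound_nonneg[OF f] .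
    have "norm (f (\<Phi> x) - f (\<Phi> y)) \<le> L powr \<beta> * M * norm (x - y) powr \<beta>" for x y
    proof -
      have "norm (f (\<Phi> x) - f (\<Phi> y)) \<le> M * norm (\<Phi> x - \<Phi> y) powr \<beta>"
        using f by auto
      also have "\<dots> \<le> M * (L * norm (x - y)) powr \<beta>"
        using M \<beta> lip by (intro mult_left_mono powr_mono2) auto
      also have "\<dots> = L powr \<beta> * M * norm (x - y) powr \<beta>"
        using L by (simp add: powr_mult)
      finally show ?thesis .
    qed
    moreover have "M \<le> L powr \<beta> * M"
      using L \<beta> M mult_right_mono[OF ge_one_powr_ge_zero[of L \<beta>], of M] by simp
    then have "norm (f (\<Phi> x)) \<le> L powr \<beta> * M" for x
      using f by (auto intro: order_trans)
    ultimately show ?thesis by auto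
  qed
  moreover have "1 \<le> L powr \<beta>"
    using L \<beta> by (simp add: ge_one_powr_ge_zero)
  ultimately show ?case by blast
next
  case (Suc n)
  from Suc.IH[of "2 * K"] Suc.prems obtain C where C: "C \<ge> 1" and
    comp: "\<And>M (f::'a \<Rightarrow> 'b) \<Phi>. holder_bound \<beta> n M f \<Longrightarrow> holder_bound \<beta> n (2 * K) (\<lambda>x. \<Phi> x - x) \<Longrightarrow>
      (\<And>x y. norm (\<Phi> x - \<Phi> y) \<le> L * norm (x - y)) \<Longrightarrow> holder_bound \<beta> n (C * M) (\<lambda>x. f (\<Phi> x))"
    by (auto simp: imp_conjL)
  \<comment> \<open>The summand 1 covers the values of f \<circ> \<Phi>. The rest bounds the
    derivative: one product estimate per basis vector, with coefficients bounded by 1 + K and the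
    induction constant C.\<close>
  define C' where "C' = 1 + real DIM('a) * (2 * 4 ^ n * (1 + K) * C)"
  have "holder_bound \<beta> (Suc n) (C' * M) (\<lambda>x. f (\<Phi> x))"
    if f: "holder_bound \<beta> (Suc n) M f" and \<Phi>: "holder_bound \<beta> (Suc n) K (\<lambda>x. \<Phi> x - x)"
      and lip: "\<And>x y. norm (\<Phi> x - \<Phi> y) \<le> L * norm (x - y)"
    for M and f :: "'a \<Rightarrow> 'b" and \<Phi>
  proof -
    have M: "0 \<le> M" using holder_bound_nonneg[OF f] .
    let ?D = "\<lambda>x v. frechet_derivative (\<lambda>x. \<Phi> x - x) (at x) v"
    have D\<Phi>: "(\<Phi> has_derivative (\<lambda>v. ?D x v + v)) (at x)" for x
      using has_derivative_add[OF holder_bound_has_derivative[OF \<Phi>, of x] has_derivative_ident]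
      by simp
    show ?thesis
    proof (rule holder_bound_SucI)
      have "0 \<le> real DIM('a) * (2 * 4 ^ n * (1 + K) * C)"
        using Suc.prems C by (intro mult_nonneg_nonneg) auto
      then have "1 * M \<le> C' * M"
        unfolding C'_def using M by (intro mult_right_mono) auto
      then show "norm (f (\<Phi> x)) \<le> C' * M" for x
        using holder_bound_norm[OF f, of "\<Phi> x"] by simp
      show "((\<lambda>x. f (\<Phi> x)) has_derivative
          (\<lambda>v. frechet_derivative f (at (\<Phi> x)) (?D x v + v))) (at x)" for x
        using has_derivative_compose[OF D\<Phi> holder_bound_has_derivative[OF f]] .
      fix v :: 'a assume v: "norm v \<le> 1"
      \<comment> \<open>Both the base point and the argument of Df depend on x, so this is not yet a
        composition with \<Phi>. The basis expansion separates the two: scalar coefficients times g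
        \<circ> \<Phi>, where g is the derivative of f in the fixed direction b.\<close>
      have eq: "frechet_derivative f (at (\<Phi> x)) (?D x v + v) =
          (\<Sum>b\<in>Basis. ((?D x v + v) \<bullet> b) *\<^sub>R frechet_derivative f (at (\<Phi> x)) b)" for x
      proof -
        have lin: "linear (frechet_derivative f (at (\<Phi> x)))"
          using f by (intro linear_frechet_derivative) auto
        show ?thesis
          by (subst euclidean_representation[of "?D x v + v", symmetric])
            (simp only: linear_sum[OF lin] linear_scale[OF lin])
      qed
      have "holder_bound \<beta> n (2 * 4 ^ n * (1 + K) * (C * M))
          (\<lambda>x. ((?D x v + v) \<bullet> b) *\<^sub>R frechet_derivative f (at (\<Phi> x)) b)" if b: "b \<in> Basis" for b
      proof (rule holder_bound_mult)
        have "holder_bound \<beta> n (K + norm v) (\<lambda>x. ?D x v + v)"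
          using \<Phi> v by (intro holder_bound_add holder_bound_const holder_bound_frechet_derivative_unit)
        then show "holder_bound \<beta> n (1 + K) (\<lambda>x. (?D x v + v) \<bullet> b)"
          using v b by (intro holder_bound_inner) (auto elim!: holder_bound_mono)
        show "holder_bound \<beta> n (C * M) (\<lambda>x. frechet_derivative f (at (\<Phi> x)) b)"
          using \<Phi> f b lip
          by (intro comp[where f = "\<lambda>x. frechet_derivative f (at x) b"] holder_bound_Suc_imp
              holder_bound_frechet_derivative_unit) auto
      qed
      then have "holder_bound \<beta> n (real DIM('a) * (2 * 4 ^ n * (1 + K) * (C * M)))
          (\<lambda>x. frechet_derivative f (at (\<Phi> x)) (?D x v + v))"
        unfolding eq by (intro holder_bound_sum) auto
      then show "holder_bound \<beta> n (C' * M) (\<lambda>x. frechet_derivative f (at (\<Phi> x)) (?D x v + v))"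
        by (rule holder_bound_mono) (use M in \<open>simp add: C'_def algebra_simps\<close>)
    qed
  qed
  moreover have "1 \<le> C'"
    using C Suc.prems unfolding C'_def by simp
  ultimately show ?case by blast
qed

end

section \<open>Limits and integrals\<close>

context holder_exponent
begin

text \<open>Along the segment from x to y the derivative changes by at most 2 M |y - x|^\<beta>. The
  left side is linear in f together with its derivative, so the inequality survives limits and
  integrals; \<open>has_derivative_remainderI\<close> then reads the derivative back off.\<close>

lemma holder_bound_remainder:
  fixes f :: "'a::euclidean_space \<Rightarrow> 'b::real_normed_vector"
  assumes f: "holder_bound \<beta> (Suc n) M f"
  shows "norm (f y - f x - frechet_derivative f (at x) (y - x)) \<le> 2 * M * norm (y - x) powr \<beta> * norm (y - x)"
proof -
  have M: "0 \<le> M" using holder_bound_nonneg[OF f] .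
  have "norm (f y - f x - frechet_derivative f (at x) (y - x)) \<le>
      norm (y - x) * (2 * M * norm (y - x) powr \<beta>)"
  proof (rule differentiable_bound_linearization[where S = "closed_segment x y"])
    show "x + t *\<^sub>R (y - x) \<in> closed_segment x y" if "t \<in> {0..1}" for t
      using that by (auto simp: closed_segment_def algebra_simps intro!: exI[of _ t])
    show "(f has_derivative frechet_derivative f (at z)) (at z within closed_segment x y)" for z
      by (rule has_derivative_at_withinI[OF holder_bound_has_derivative[OF f]])
    fix z assume z: "z \<in> closed_segment x y"
    show "onorm (frechet_derivative f (at z) - frechet_derivative f (at x)) \<le>
        2 * M * norm (y - x) powr \<beta>"
    proof (rule onorm_le)
      fix v :: 'a
      have "norm (z - x) \<le> norm (y - x)"
        using segment_bound(1)[OF z] .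
      then have "2 * (norm v * M) * norm (z - x) powr \<beta> \<le> 2 * (norm v * M) * norm (y - x) powr \<beta>"
        using M \<beta> by (intro mult_left_mono powr_mono2) auto
      then show "norm ((frechet_derivative f (at z) - frechet_derivative f (at x)) v) \<le>
          2 * M * norm (y - x) powr \<beta> * norm v"
        using holder_bound_Holder[OF holder_bound_frechet_derivative[OF f], of z v x]
        by (simp add: algebra_simps)
    qed
  qed auto
  then show ?thesis by (simp add: mult.commute)
qed

lemma has_derivative_remainderI:
  fixes f :: "'a::euclidean_space \<Rightarrow> 'b::real_normed_vector"
  assumes L: "linear L"
    and rem: "\<And>y. norm (f y - f x - L (y - x)) \<le> C * norm (y - x) powr \<beta> * norm (y - x)"
  shows "(f has_derivative L) (at x)"
  unfolding has_derivative_iff_norm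
proof
  show "bounded_linear L"
    using L by (simp add: linear_conv_bounded_linear)
  show "((\<lambda>y. norm (f y - f x - L (y - x)) / norm (y - x)) \<longlongrightarrow> 0) (at x)"
  proof (rule Lim_null_comparison[where g = "\<lambda>y. C * norm (y - x) powr \<beta>"])
    have "norm (norm (f y - f x - L (y - x)) / norm (y - x)) \<le> C * norm (y - x) powr \<beta>"
      if "y \<noteq> x" for y
      using rem[of y] that by (simp add: divide_simps)
    then show "\<forall>\<^sub>F y in at x. norm (norm (f y - f x - L (y - x)) / norm (y - x)) \<le> C * norm (y - x) powr \<beta>"
      by (auto simp: eventually_at_filter)
    have "((\<lambda>y. norm (y - x) powr \<beta>) \<longlongrightarrow> 0 powr \<beta>) (at x)"
      using \<beta> by (intro tendsto_powr' tendsto_eq_intros) (auto intro!: tendsto_eq_intros)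
    then show "((\<lambda>y. C * norm (y - x) powr \<beta>) \<longlongrightarrow> 0) (at x)"
      by (auto intro: tendsto_mult_right_zero)
  qed
qed

text \<open>A difference quotient with step h replaces the derivative up to an error of order
  h^\<beta>. Choosing h first and then the size of the values makes derivatives small wherever the
  map is small, uniformly over a bounded family. This serves both the convergence of derivatives and
  their decay at infinity.\<close>

lemma holder_bound_interpolation:
  assumes f: "holder_bound \<beta> (Suc n) M f" and h: "0 < h"
  shows "norm (frechet_derivative f (at x) v) \<le>
    (norm (f (x + h *\<^sub>R v)) + norm (f x)) / h + 2 * M * norm v powr \<beta> * norm v * h powr \<beta>"
proof -
  let ?D = "frechet_derivative f (at x)"
  have "h * norm (?D v) = norm (?D (h *\<^sub>R v))"
    using linear_frechet_derivative[of f "at x"] f h by (simp add: linear_scale)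
  also have "\<dots> = norm (f (x + h *\<^sub>R v) - f x - (f (x + h *\<^sub>R v) - f x - ?D (h *\<^sub>R v)))"
    by simp
  also have "\<dots> \<le> norm (f (x + h *\<^sub>R v)) + norm (f x) + norm (f (x + h *\<^sub>R v) - f x - ?D (h *\<^sub>R v))"
    by (intro order_trans[OF norm_triangle_ineq4] add_mono order_refl)
  also have "norm (f (x + h *\<^sub>R v) - f x - ?D (h *\<^sub>R v)) \<le> 2 * M * norm (h *\<^sub>R v) powr \<beta> * norm (h *\<^sub>R v)"
    using holder_bound_remainder[OF f, of "x + h *\<^sub>R v" x] by simp
  also have "\<dots> = h * (2 * M * norm v powr \<beta> * norm v * h powr \<beta>)"
    using h by (simp add: powr_mult)
  finally show ?thesis
    using h by (simp add: field_simps)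
qed

lemma small_step:
  assumes "0 < e"
  obtains h :: real where "0 < h" "h \<le> 1" "c * h powr \<beta> < e"
proof -
  have "((\<lambda>h. c * h powr \<beta>) \<longlongrightarrow> c * 0 powr \<beta>) (at_right 0)"
    using \<beta> by (intro tendsto_intros tendsto_powr')
      (auto simp: eventually_at_filter intro!: tendsto_eq_intros)
  then have "\<forall>\<^sub>F h in at_right 0. c * h powr \<beta> < e"
    using assms by (intro order_tendstoD) auto
  moreover have "\<forall>\<^sub>F h in at_right (0::real). 0 < h \<and> h < 1"
    by (auto simp: eventually_at_right_field intro!: exI[of _ 1])
  ultimately have "\<forall>\<^sub>F h in at_right 0. c * h powr \<beta> < e \<and> 0 < h \<and> h < 1"
    by (rule eventually_conj)
  then obtain h where "c * h powr \<beta> < e \<and> 0 < h \<and> h < 1"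
    using eventually_happens' trivial_limit_at_right_real by blast
  then show ?thesis by (auto intro!: that[of h])
qed

lemma frechet_derivative_diff_holder:
  assumes "holder_bound \<beta> (Suc n) M f" "holder_bound \<beta> (Suc n) K g"
  shows "frechet_derivative (\<lambda>x. f x - g x) (at x) =
    (\<lambda>v. frechet_derivative f (at x) v - frechet_derivative g (at x) v)"
  using has_derivative_diff[OF holder_bound_has_derivative[OF assms(1)] holder_bound_has_derivative[OF assms(2)]]
  by (rule frechet_derivative_at[symmetric])

text \<open>Pointwise convergence forces the derivatives to converge: interpolation for f k - f j,
  which is bounded by M + M, makes them Cauchy at every point. The remainder estimate passes to the
  limit and identifies the limit of the derivatives as the derivative of g, to which the induction
  hypothesis applies. The constant M is preserved exactly.\<close>

lemma holder_bound_limit: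
  fixes f :: "nat \<Rightarrow> 'a::euclidean_space \<Rightarrow> 'b::banach"
  assumes "\<And>k. holder_bound \<beta> n M (f k)" "\<And>x. (\<lambda>k. f k x) \<longlonglongrightarrow> g x"
  shows "holder_bound \<beta> n M g"
  using assms
proof (induction n arbitrary: f g)
  case 0
  show ?case
    unfolding holder_bound.simps
  proof (intro conjI allI)
    show "norm (g x) \<le> M" for x
      using 0 by (intro Lim_norm_ubound[OF _ 0(2)]) auto
    show "norm (g x - g y) \<le> M * norm (x - y) powr \<beta>" for x y
      using 0 by (intro Lim_norm_ubound[OF _ tendsto_diff[OF 0(2) 0(2)]]) auto
  qed
next
  case (Suc n)
  let ?D = "\<lambda>k x v. frechet_derivative (f k) (at x) v"
  have "Cauchy (\<lambda>k. ?D k x v)" for x v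
  proof (rule CauchyI)
    fix e :: real assume e: "0 < e"
    obtain h where h: "0 < h" "(2 * (M + M) * norm v powr \<beta> * norm v) * h powr \<beta> < e / 2"
      using small_step[of "e / 2"] e by (metis half_gt_zero)
    have "Cauchy (\<lambda>k. f k x)" "Cauchy (\<lambda>k. f k (x + h *\<^sub>R v))"
      using Suc.prems(2) LIMSEQ_imp_Cauchy by blast+
    \<comment> \<open>Two values below e h / 4, divided by h, contribute e / 2; the error of the
      step h contributes the other half.\<close>
    moreover have eh: "0 < e * h / 4" using e h by simp
    ultimately obtain N1 N2 where N: "\<And>k j. k \<ge> N1 \<Longrightarrow> j \<ge> N1 \<Longrightarrow> norm (f k x - f j x) < e * h / 4"
      "\<And>k j. k \<ge> N2 \<Longrightarrow> j \<ge> N2 \<Longrightarrow> norm (f k (x + h *\<^sub>R v) - f j (x + h *\<^sub>R v)) < e * h / 4"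
      by (meson CauchyD)
    show "\<exists>N. \<forall>k\<ge>N. \<forall>j\<ge>N. norm (?D k x v - ?D j x v) < e"
    proof (intro exI[of _ "max N1 N2"] allI impI)
      fix k j assume kj: "max N1 N2 \<le> k" "max N1 N2 \<le> j"
      have "norm (?D k x v - ?D j x v) \<le>
          (norm (f k (x + h *\<^sub>R v) - f j (x + h *\<^sub>R v)) + norm (f k x - f j x)) / h
          + 2 * (M + M) * norm v powr \<beta> * norm v * h powr \<beta>"
        using holder_bound_interpolation[OF holder_bound_diff[OF Suc.prems(1)[of k] Suc.prems(1)[of j]] h(1), of x v]
        by (simp only: frechet_derivative_diff_holder[OF Suc.prems(1) Suc.prems(1)])
      also have "\<dots> < (e * h / 4 + e * h / 4) / h + e / 2"
        using N(1)[of k j] N(2)[of k j] kj h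
        by (intro add_strict_mono divide_strict_right_mono) auto
      also have "\<dots> = e" using h by (simp add: field_simps)
      finally show "norm (?D k x v - ?D j x v) < e" .
    qed
  qed
  then have L: "(\<lambda>k. ?D k x v) \<longlonglongrightarrow> lim (\<lambda>k. ?D k x v)" for x v
    using Cauchy_convergent convergent_LIMSEQ_iff by blast
  define L where "L x v = lim (\<lambda>k. ?D k x v)" for x v
  note L = L[folded L_def]
  have lin: "linear (?D k x)" for k x
    using Suc.prems(1) by (intro linear_frechet_derivative) simp
  have "linear (L x)" for x
  proof (rule linearI)
    show "L x (v + w) = L x v + L x w" for v w
      using L[of x "v + w"] tendsto_add[OF L[of x v] L[of x w]] LIMSEQ_unique
      by (simp add: linear_add[OF lin]) blast
    show "L x (c *\<^sub>R v) = c *\<^sub>R L x v" for c v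
      using L[of x "c *\<^sub>R v"] tendsto_scaleR[OF tendsto_const L[of x v]] LIMSEQ_unique
      by (simp add: linear_scale[OF lin]) blast
  qed
  moreover have "norm (g y - g x - L x (y - x)) \<le> (2 * M) * norm (y - x) powr \<beta> * norm (y - x)" for x y
    using holder_bound_remainder[OF Suc.prems(1)]
    by (intro Lim_norm_ubound[OF _ tendsto_diff[OF tendsto_diff[OF Suc.prems(2) Suc.prems(2)] L]]) auto
  ultimately have "(g has_derivative L x) (at x)" for x
    by (rule has_derivative_remainderI)
  moreover have "norm (g x) \<le> M" for x
    using holder_bound_norm[OF Suc.prems(1)] by (intro Lim_norm_ubound[OF _ Suc.prems(2)]) auto
  moreover have "holder_bound \<beta> n M (\<lambda>x. L x v)" if "norm v \<le> 1" for v
    using that Suc.prems(1) by (intro Suc.IH[OF _ L] holder_bound_frechet_derivative_unit)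
  ultimately show ?case
    by (intro holder_bound_SucI)
qed

section \<open>Differentiation under the integral sign\<close>

lemma frechet_derivative_difference_quotient:
  assumes f: "f differentiable at x"
  shows "((\<lambda>h. (f (x + h *\<^sub>R v) - f x) /\<^sub>R h) \<longlongrightarrow> frechet_derivative f (at x) v) (at 0)"
proof -
  let ?D = "frechet_derivative f (at x)"
  have "(f has_derivative ?D) (at (x + 0 *\<^sub>R v))"
    using f by (simp add: frechet_derivative_works)
  then have "((\<lambda>h. f (x + h *\<^sub>R v)) has_derivative (\<lambda>h. ?D (0 + h *\<^sub>R v))) (at 0)"
    by (rule has_derivative_compose[rotated]) (auto intro!: derivative_eq_intros)
  then have lim: "((\<lambda>h. norm (f (x + h *\<^sub>R v) - f x - h *\<^sub>R ?D v) / norm h) \<longlongrightarrow> 0) (at 0)"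
    using linear_frechet_derivative[OF f] by (simp add: has_derivative_iff_norm linear_scale)
  have "norm ((f (x + h *\<^sub>R v) - f x) /\<^sub>R h - ?D v) = norm (f (x + h *\<^sub>R v) - f x - h *\<^sub>R ?D v) / norm h"
    if "h \<noteq> 0" for h
  proof -
    have "(f (x + h *\<^sub>R v) - f x) /\<^sub>R h - ?D v = (f (x + h *\<^sub>R v) - f x - h *\<^sub>R ?D v) /\<^sub>R h"
      using that by (simp add: scaleR_diff_right)
    then show ?thesis by (simp add: divide_inverse mult.commute)
  qed
  then have "((\<lambda>h. norm ((f (x + h *\<^sub>R v) - f x) /\<^sub>R h - ?D v)) \<longlongrightarrow> 0) (at 0)"
    by (intro Lim_transform_eventually[OF lim]) (auto simp: eventually_at_filter)
  then show ?thesis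
    by (rule LIM_zero_cancel[OF tendsto_norm_zero_cancel])
qed

text \<open>The derivative is the pointwise limit of the difference quotients with steps 1 / (k +
  1), each of them measurable in s.\<close>

lemma frechet_derivative_measurable:
  fixes F :: "'s \<Rightarrow> 'a::euclidean_space \<Rightarrow> 'b::{banach,second_countable_topology}"
  assumes "\<And>s. s \<in> space N \<Longrightarrow> F s differentiable at x"
    and [measurable]: "\<And>x. (\<lambda>s. F s x) \<in> borel_measurable N"
  shows "(\<lambda>s. frechet_derivative (F s) (at x) v) \<in> borel_measurable N"
proof (rule borel_measurable_LIMSEQ_metric)
  show "(\<lambda>s. (F s (x + inverse (real (Suc k)) *\<^sub>R v) - F s x) /\<^sub>R inverse (real (Suc k))) \<in> borel_measurable N" for k
    by measurable
  fix s assume s: "s \<in> space N"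
  have "((\<lambda>h. (F s (x + h *\<^sub>R v) - F s x) /\<^sub>R h) \<longlongrightarrow> frechet_derivative (F s) (at x) v) (at 0)"
    using assms(1)[OF s] by (rule frechet_derivative_difference_quotient)
  moreover have "filterlim (\<lambda>k. inverse (real (Suc k))) (at 0) sequentially"
    by (rule filterlim_atI[OF LIMSEQ_inverse_real_of_nat]) simp
  ultimately show "(\<lambda>k. (F s (x + inverse (real (Suc k)) *\<^sub>R v) - F s x) /\<^sub>R inverse (real (Suc k)))
      \<longlonglongrightarrow> frechet_derivative (F s) (at x) v"
    by (rule filterlim_compose)
qed

text \<open>The remainder estimates of the maps F s integrate to a remainder estimate for the
  integral, with the integral of m in place of M and the integral \<open>L\<close> of the
  derivatives as the candidate for the derivative.\<close>

lemma holder_bound_integral: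
  fixes F :: "real \<Rightarrow> 'a::euclidean_space \<Rightarrow> 'b::{banach,second_countable_topology}"
  assumes m: "integrable N m"
    and "\<And>s. s \<in> space N \<Longrightarrow> holder_bound \<beta> n (m s) (F s)"
    and "\<And>x. (\<lambda>s. F s x) \<in> borel_measurable N"
  shows "holder_bound \<beta> n (\<integral>s. m s \<partial>N) (\<lambda>x. \<integral>s. F s x \<partial>N)"
  using assms(2,3)
proof (induction n arbitrary: F)
  case 0
  have i: "integrable N (\<lambda>s. F s x)" for x
    using 0(1) by (intro Bochner_Integration.integrable_bound[OF m 0(2)] AE_I2)
      (auto intro: order_trans[OF _ abs_ge_self])
  show ?case
    unfolding holder_bound.simps
  proof (intro conjI allI)
    show "norm (\<integral>s. F s x \<partial>N) \<le> (\<integral>s. m s \<partial>N)" for x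
      using 0(1) by (intro Bochner_Integration.integral_norm_bound_integral i m) auto
    have "norm (\<integral>s. F s x - F s y \<partial>N) \<le> (\<integral>s. m s * norm (x - y) powr \<beta> \<partial>N)" for x y
      using 0(1) by (intro Bochner_Integration.integral_norm_bound_integral
        Bochner_Integration.integrable_diff i integrable_mult_left m) auto
    then show "norm ((\<integral>s. F s x \<partial>N) - (\<integral>s. F s y \<partial>N)) \<le> (\<integral>s. m s \<partial>N) * norm (x - y) powr \<beta>" for x y
      by (simp add: Bochner_Integration.integral_diff[OF i i])
  qed
next
  case (Suc n)
  let ?D = "\<lambda>s x v. frechet_derivative (F s) (at x) v"
  have b: "norm (F s x) \<le> m s" if "s \<in> space N" for s x
    using holder_bound_norm[OF Suc.prems(1)[OF that]] .
  have i: "integrable N (\<lambda>s. F s x)" for x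
    using b by (intro Bochner_Integration.integrable_bound[OF m Suc.prems(2)] AE_I2)
      (auto intro: order_trans[OF _ abs_ge_self])
  have meas: "(\<lambda>s. ?D s x v) \<in> borel_measurable N" for x v
    using Suc.prems by (intro frechet_derivative_measurable) auto
  have Di: "integrable N (\<lambda>s. ?D s x v)" for x v
  proof (rule Bochner_Integration.integrable_bound[OF integrable_mult_left[OF m, of "norm v"] meas], rule AE_I2)
    fix s assume "s \<in> space N"
    from holder_bound_norm_frechet_derivative[OF Suc.prems(1)[OF this], of x v]
    show "norm (?D s x v) \<le> norm (m s * norm v)" by (auto intro: order_trans[OF _ abs_ge_self])
  qed
  define L where "L x v = (\<integral>s. ?D s x v \<partial>N)" for x v
  have lin: "linear (?D s x)" if "s \<in> space N" for s x
    using Suc.prems(1)[OF that] by (intro linear_frechet_derivative) simp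
  have "linear (L x)" for x
  proof (rule linearI)
    show "L x (v + w) = L x v + L x w" for v w
      unfolding L_def Bochner_Integration.integral_add[OF Di Di, symmetric]
      by (intro Bochner_Integration.integral_cong refl) (simp add: linear_add[OF lin])
    show "L x (c *\<^sub>R v) = c *\<^sub>R L x v" for c v
      unfolding L_def integral_scaleR_right[symmetric]
      by (intro Bochner_Integration.integral_cong refl) (simp add: linear_scale[OF lin])
  qed
  moreover have "norm ((\<integral>s. F s y \<partial>N) - (\<integral>s. F s x \<partial>N) - L x (y - x)) \<le>
      (2 * (\<integral>s. m s \<partial>N)) * norm (y - x) powr \<beta> * norm (y - x)" for x y
  proof -
    have "(\<integral>s. F s y \<partial>N) - (\<integral>s. F s x \<partial>N) - L x (y - x) = (\<integral>s. F s y - F s x - ?D s x (y - x) \<partial>N)"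
      by (simp add: L_def i Di)
    also have "norm \<dots> \<le> (\<integral>s. m s * (2 * norm (y - x) powr \<beta> * norm (y - x)) \<partial>N)"
    proof (rule Bochner_Integration.integral_norm_bound_integral)
      show "norm (F s y - F s x - ?D s x (y - x)) \<le> m s * (2 * norm (y - x) powr \<beta> * norm (y - x))"
        if "s \<in> space N" for s
        using holder_bound_remainder[OF Suc.prems(1)[OF that], of y x] by (simp add: mult_ac)
    qed (use i Di m in auto)
    finally show ?thesis by (simp add: mult_ac)
  qed
  ultimately have "((\<lambda>x. \<integral>s. F s x \<partial>N) has_derivative L x) (at x)" for x
    by (rule has_derivative_remainderI)
  moreover have "norm (\<integral>s. F s x \<partial>N) \<le> (\<integral>s. m s \<partial>N)" for x
    using b by (intro Bochner_Integration.integral_norm_bound_integral i m) auto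
  moreover have "holder_bound \<beta> n (\<integral>s. m s \<partial>N) (\<lambda>x. L x v)" if "norm v \<le> 1" for v
    unfolding L_def using that Suc.prems(1) by (intro Suc.IH meas holder_bound_frechet_derivative_unit)
  ultimately show ?case
    by (intro holder_bound_SucI)
qed

end

section \<open>Comparison with the Hoelder norm\<close>

lemma iter_deriv_Nil: "iter_deriv f [] = f"
  by (rule ext) simp

text \<open>\<open>iter_deriv\<close> peels its list at the head, the direction differentiated last,
  whereas \<open>holder_bound\<close> differentiates f first. Peeling the other end of the list
  matches the two recursions.\<close>

lemma iter_deriv_snoc:
  "iter_deriv f (vs @ [v]) = iter_deriv (\<lambda>x. frechet_derivative f (at x) v) vs"
proof (induction vs)
  case Nil
  show ?case by (rule ext) (simp add: iter_deriv_Nil)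
next
  case (Cons w vs)
  then show ?case by (intro ext) simp
qed

lemma Cn_map_Suc:
  "Cn_map (Suc n) f \<longleftrightarrow> (\<forall>x. f differentiable at x) \<and> continuous_on UNIV f \<and>
    (\<forall>v. Cn_map n (\<lambda>x. frechet_derivative f (at x) v))"
proof
  assume f: "Cn_map (Suc n) f"
  have "Cn_map n (\<lambda>x. frechet_derivative f (at x) v)" for v
    using f unfolding Cn_map_def iter_deriv_snoc[symmetric] by auto
  moreover have "iter_deriv f [] differentiable at x" "continuous_on UNIV (iter_deriv f [])" for x
    using f unfolding Cn_map_def by (auto dest: spec[of _ "[]"] simp del: iter_deriv.simps)
  ultimately show "(\<forall>x. f differentiable at x) \<and> continuous_on UNIV f \<and>
      (\<forall>v. Cn_map n (\<lambda>x. frechet_derivative f (at x) v))"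
    by (simp add: iter_deriv_Nil)
next
  assume f: "(\<forall>x. f differentiable at x) \<and> continuous_on UNIV f \<and>
    (\<forall>v. Cn_map n (\<lambda>x. frechet_derivative f (at x) v))"
  show "Cn_map (Suc n) f"
    unfolding Cn_map_def
  proof (intro conjI allI impI)
    show "iter_deriv f vs differentiable at x" if "length vs < Suc n" for vs x
      using that f by (cases vs rule: rev_cases) (auto simp: iter_deriv_Nil iter_deriv_snoc Cn_map_def)
    show "continuous_on UNIV (iter_deriv f vs)" if "length vs \<le> Suc n" for vs
      using that f by (cases vs rule: rev_cases) (auto simp: iter_deriv_Nil iter_deriv_snoc Cn_map_def)
  qed
qed

definition unit_list :: "'a::real_normed_vector list \<Rightarrow> bool" where
  "unit_list vs \<longleftrightarrow> (\<forall>v\<in>set vs. norm v \<le> 1)"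

lemma unit_list_simps [simp]: "unit_list []" "unit_list (vs @ [v]) \<longleftrightarrow> unit_list vs \<and> norm v \<le> 1"
  by (auto simp: unit_list_def)

lemma multi_onorm_le_iff:
  "0 \<le> M \<Longrightarrow> multi_onorm l T \<le> ennreal M \<longleftrightarrow>
    (\<forall>vs. length vs = l \<longrightarrow> unit_list vs \<longrightarrow> norm (T vs) \<le> M)"
  by (auto simp: multi_onorm_def SUP_le_iff unit_list_def)

lemma multi_onorm_divide_le_iff:
  "0 \<le> M \<Longrightarrow> 0 < p \<Longrightarrow> multi_onorm l T / ennreal p \<le> ennreal M \<longleftrightarrow>
    (\<forall>vs. length vs = l \<longrightarrow> unit_list vs \<longrightarrow> norm (T vs) \<le> M * p)"
  by (auto simp: multi_onorm_def SUP_divide_ennreal SUP_le_iff unit_list_def divide_ennreal divide_simps)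

lemma ennreal_tendsto_zeroI:
  fixes f :: "'a \<Rightarrow> ennreal"
  assumes "\<And>e::real. 0 < e \<Longrightarrow> \<forall>\<^sub>F x in F. f x \<le> ennreal e"
  shows "(f \<longlongrightarrow> 0) F"
proof (rule order_tendstoI)
  fix a :: ennreal assume "0 < a"
  then obtain b where b: "0 < b" "b < a"
    using dense by blast
  then have "ennreal (enn2real b) = b" "0 < enn2real b"
    using less_trans[of b a top] by (cases b rule: ennreal_cases; auto simp: less_top[symmetric])+
  then show "\<forall>\<^sub>F x in F. f x < a"
    using assms[of "enn2real b"] b by (auto elim!: eventually_mono)
qed auto

context holder_exponent
begin

lemma holder_bound_imp_Cn_map: "holder_bound \<beta> n M f \<Longrightarrow> Cn_map n f"
proof (induction n arbitrary: M f)
  case 0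
  then show ?case
    using holder_bound_continuous[OF 0] by (auto simp: Cn_map_def iter_deriv_Nil)
next
  case (Suc n)
  have "Cn_map n (\<lambda>x. frechet_derivative f (at x) v)" for v
    using Suc.IH[OF holder_bound_frechet_derivative[OF Suc.prems]] .
  with Suc.prems show ?case
    using holder_bound_continuous[OF Suc.prems] by (auto simp: Cn_map_Suc)
qed

lemma holder_bound_imp_iter_deriv:
  "holder_bound \<beta> n M f \<Longrightarrow> unit_list vs \<Longrightarrow>
    (length vs \<le> n \<longrightarrow> norm (iter_deriv f vs x) \<le> M) \<and>
    (length vs = n \<longrightarrow> norm (iter_deriv f vs x - iter_deriv f vs y) \<le> M * norm (x - y) powr \<beta>)"
proof (induction n arbitrary: f vs)
  case 0
  then show ?case by (auto simp: iter_deriv_Nil)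
next
  case (Suc n)
  show ?case
  proof (cases vs rule: rev_cases)
    case Nil
    then show ?thesis using holder_bound_norm[OF Suc.prems(1)] by (simp add: iter_deriv_Nil)
  next
    case (snoc ws v)
    then show ?thesis
      using Suc.IH[of "\<lambda>x. frechet_derivative f (at x) v" ws] Suc.prems by (auto simp: iter_deriv_snoc)
  qed
qed

lemma iter_deriv_imp_holder_bound:
  assumes "Cn_map n f"
    and "\<And>vs x. unit_list vs \<Longrightarrow> length vs \<le> n \<Longrightarrow> norm (iter_deriv f vs x) \<le> M"
    and "\<And>vs x y. unit_list vs \<Longrightarrow> length vs = n \<Longrightarrow>
      norm (iter_deriv f vs x - iter_deriv f vs y) \<le> M * norm (x - y) powr \<beta>"
  shows "holder_bound \<beta> n M f"
  using assms
proof (induction n arbitrary: f)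
  case 0
  then show ?case using 0(2)[of "[]"] 0(3)[of "[]"] by simp
next
  case (Suc n)
  have "holder_bound \<beta> n M (\<lambda>x. frechet_derivative f (at x) v)" if v: "norm v \<le> 1" for v
  proof (rule Suc.IH)
    show "Cn_map n (\<lambda>x. frechet_derivative f (at x) v)"
      using Suc.prems(1) by (simp add: Cn_map_Suc)
  qed (use Suc.prems(2)[of "_ @ [v]"] Suc.prems(3)[of "_ @ [v]"] v in \<open>auto simp: iter_deriv_snoc\<close>)
  moreover have "norm (f x) \<le> M" for x
    using Suc.prems(2)[of "[]" x] by simp
  ultimately show ?case
    using Suc.prems(1) by (simp add: Cn_map_Suc)
qed

lemma holder_norm_le_iff:
  fixes f :: "'a::euclidean_space \<Rightarrow> 'b::real_normed_vector"
  assumes M: "0 \<le> M"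
  shows "holder_norm n \<beta> f \<le> ennreal M \<longleftrightarrow>
    (\<forall>vs x. unit_list vs \<longrightarrow> length vs \<le> n \<longrightarrow> norm (iter_deriv f vs x) \<le> M) \<and>
    (\<forall>vs x y. unit_list vs \<longrightarrow> length vs = n \<longrightarrow>
      norm (iter_deriv f vs x - iter_deriv f vs y) \<le> M * norm (x - y) powr \<beta>)"
proof -
  have "(SUP (x, l)\<in>UNIV \<times> {..n}. multi_onorm l (\<lambda>vs. iter_deriv f vs x)) \<le> ennreal M \<longleftrightarrow>
      (\<forall>vs x. unit_list vs \<longrightarrow> length vs \<le> n \<longrightarrow> norm (iter_deriv f vs x) \<le> M)"
    by (auto simp: SUP_le_iff multi_onorm_le_iff[OF M])
  moreover have "(SUP (x, y)\<in>{(x, y). x \<noteq> y}.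
        multi_onorm n (\<lambda>vs. iter_deriv f vs x - iter_deriv f vs y) / ennreal (norm (x - y) powr \<beta>)) \<le> ennreal M \<longleftrightarrow>
      (\<forall>x y. x \<noteq> y \<longrightarrow> (\<forall>vs. unit_list vs \<longrightarrow> length vs = n \<longrightarrow>
        norm (iter_deriv f vs x - iter_deriv f vs y) \<le> M * norm (x - y) powr \<beta>))"
    by (auto simp: SUP_le_iff multi_onorm_divide_le_iff[OF M])
  \<comment> \<open>On the diagonal both sides vanish, so the pairs that the Hoelder quotient
    excludes can be put back.\<close>
  moreover have "norm (iter_deriv f vs x - iter_deriv f vs y) \<le> M * norm (x - y) powr \<beta>" if "x = y" for vs x y
    using that by simp
  ultimately show ?thesis
    unfolding holder_norm_def max.bounded_iff by blast
qed

text \<open>\<open>Cn_map\<close> appears on the right because \<open>frechet_derivative\<close> has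
  an unspecified value where f is not differentiable, so that a finite norm does not by itself yield
  smoothness. The hypothesis 0 \<le> M keeps \<open>ennreal\<close> from truncating M.\<close>

lemma holder_bound_iff_holder_norm:
  "0 \<le> M \<Longrightarrow> holder_bound \<beta> n M f \<longleftrightarrow> Cn_map n f \<and> holder_norm n \<beta> f \<le> ennreal M"
  by (auto simp: holder_norm_le_iff holder_bound_imp_Cn_map dest: holder_bound_imp_iter_deriv
      intro: iter_deriv_imp_holder_bound)

text \<open>By interpolation, all derivatives of a map with bounded Hoelder norm are small where the map
  itself is small; hence only the vanishing of the map has to be checked.\<close>

lemma iter_deriv_small:
  fixes M :: real
  assumes "0 < e" "l \<le> n"
  shows "\<exists>d>0. \<forall>(f::'a::euclidean_space \<Rightarrow> 'b::real_normed_vector) R vs x.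
    holder_bound \<beta> n M f \<longrightarrow> (\<forall>x. R \<le> norm x \<longrightarrow> norm (f x) \<le> d) \<longrightarrow>
    length vs = l \<longrightarrow> unit_list vs \<longrightarrow> R + real l \<le> norm x \<longrightarrow> norm (iter_deriv f vs x) \<le> e"
  using assms(2)
proof (induction l arbitrary: n)
  case 0
  show ?case using assms(1) by (intro exI[of _ e]) simp
next
  case (Suc l)
  then obtain n' where n': "n = Suc n'" "l \<le> n'" by (cases n) auto
  from Suc.IH[OF n'(2)] obtain d where d: "0 < d"
    and small: "\<And>(f::'a \<Rightarrow> 'b) R vs x. holder_bound \<beta> n' M f \<Longrightarrow> (\<And>x. R \<le> norm x \<Longrightarrow> norm (f x) \<le> d) \<Longrightarrow>
      length vs = l \<Longrightarrow> unit_list vs \<Longrightarrow> R + real l \<le> norm x \<Longrightarrow> norm (iter_deriv f vs x) \<le> e"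
    by blast
  \<comment> \<open>The step h pushes the interpolation error below d / 2; values bounded by d * h /
    4 give the other half after division by h. As h \<le> 1, the point x + h v lies within distance
    1 of x, so each derivative enlarges the exceptional radius by 1.\<close>
  obtain h where h: "0 < h" "h \<le> 1" "2 * M * h powr \<beta> < d / 2"
    using small_step[of "d / 2" "2 * M"] d by auto
  have "norm (iter_deriv f vs x) \<le> e"
    if f: "holder_bound \<beta> n M f" and fd: "\<And>x. R \<le> norm x \<Longrightarrow> norm (f x) \<le> d * h / 4"
      and vs: "length vs = Suc l" "unit_list vs" "R + real (Suc l) \<le> norm x"
    for f :: "'a \<Rightarrow> 'b" and R vs x
  proof -
    have M: "0 \<le> M" using holder_bound_nonneg[OF f] .
    obtain ws v where ws: "vs = ws @ [v]" using vs by (cases vs rule: rev_cases) auto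
    with vs have v: "norm v \<le> 1" "unit_list ws" "length ws = l" by auto
    have fS: "holder_bound \<beta> (Suc n') M f" using f n' by simp
    show ?thesis
      unfolding ws iter_deriv_snoc
    proof (rule small[where R = "R + 1"])
      show "holder_bound \<beta> n' M (\<lambda>x. frechet_derivative f (at x) v)"
        using fS v by simp
      fix x :: 'a assume x: "R + 1 \<le> norm x"
      have "norm (h *\<^sub>R v) \<le> 1" using h v mult_mono[of h 1 "norm v" 1] by simp
      then have "R \<le> norm (x + h *\<^sub>R v)"
        using x norm_diff_ineq[of x "h *\<^sub>R v"] by linarith
      then have 1: "(norm (f (x + h *\<^sub>R v)) + norm (f x)) / h \<le> (d * h / 4 + d * h / 4) / h"
        using x h by (intro divide_right_mono add_mono fd) auto
      have "norm v powr \<beta> * norm v \<le> 1 * 1"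
        using v \<beta> by (intro mult_mono powr_le1) auto
      then have 2: "2 * M * h powr \<beta> * (norm v powr \<beta> * norm v) \<le> 2 * M * h powr \<beta> * 1"
        using M by (intro mult_left_mono) auto
      have "norm (frechet_derivative f (at x) v) \<le> (norm (f (x + h *\<^sub>R v)) + norm (f x)) / h
          + 2 * M * h powr \<beta> * (norm v powr \<beta> * norm v)"
        using holder_bound_interpolation[OF fS h(1), of x v] by (simp add: mult_ac)
      also have "\<dots> \<le> d"
      proof -
        have "(d * h / 4 + d * h / 4) / h = d / 2" using h by (simp add: field_simps)
        then show ?thesis using 1 2 h by linarith
      qed
      finally show "norm (frechet_derivative f (at x) v) \<le> d" .
    qed (use v vs in auto)
  qed
  moreover have "0 < d * h / 4" using d h by simp
  ultimately show ?case by blast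
qed

lemma C0_holder_iff:
  fixes f :: "'a::euclidean_space \<Rightarrow> 'a"
  shows "f \<in> C0_holder n \<beta> \<longleftrightarrow> (\<exists>M. holder_bound \<beta> n M f) \<and> (f \<longlongrightarrow> 0) at_infinity"
proof
  assume f: "f \<in> C0_holder n \<beta>"
  then have fin: "holder_norm n \<beta> f < top" and cn: "Cn_map n f"
    by (auto simp: C0_holder_def infinity_ennreal_def)
  then have "holder_bound \<beta> n (enn2real (holder_norm n \<beta> f)) f"
    by (subst holder_bound_iff_holder_norm) auto
  moreover have "(f \<longlongrightarrow> 0) at_infinity"
  proof -
    have "multi_onorm 0 (\<lambda>vs. iter_deriv f vs x) = ennreal (norm (f x))" for x
      by (simp add: multi_onorm_def)
    moreover have "((\<lambda>x. multi_onorm 0 (\<lambda>vs. iter_deriv f vs x)) \<longlongrightarrow> 0) at_infinity"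
      using f by (auto simp: C0_holder_def)
    ultimately have "((\<lambda>x. ennreal (norm (f x))) \<longlongrightarrow> ennreal 0) at_infinity"
      by simp
    then have "((\<lambda>x. norm (f x)) \<longlongrightarrow> 0) at_infinity"
      using tendsto_enn2real by fastforce
    then show ?thesis by (rule tendsto_norm_zero_cancel)
  qed
  ultimately show "(\<exists>M. holder_bound \<beta> n M f) \<and> (f \<longlongrightarrow> 0) at_infinity" by blast
next
  assume "(\<exists>M. holder_bound \<beta> n M f) \<and> (f \<longlongrightarrow> 0) at_infinity"
  then obtain M where f: "holder_bound \<beta> n M f" and lim: "(f \<longlongrightarrow> 0) at_infinity" by auto
  have M: "0 \<le> M" using holder_bound_nonneg[OF f] .
  have "Cn_map n f" "holder_norm n \<beta> f \<le> ennreal M"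
    using f holder_bound_iff_holder_norm[OF M] by auto
  moreover have "((\<lambda>x. multi_onorm l (\<lambda>vs. iter_deriv f vs x)) \<longlongrightarrow> 0) at_infinity" if l: "l \<le> n" for l
  proof (rule ennreal_tendsto_zeroI)
    fix e :: real assume e: "0 < e"
    from iter_deriv_small[OF e l, of M] obtain d where d: "0 < d"
      and small: "\<And>R vs x. (\<And>x. R \<le> norm x \<Longrightarrow> norm (f x) \<le> d) \<Longrightarrow> length vs = l \<Longrightarrow> unit_list vs \<Longrightarrow>
        R + real l \<le> norm x \<Longrightarrow> norm (iter_deriv f vs x) \<le> e"
      using f by blast
    obtain R where R: "\<And>x. R \<le> norm x \<Longrightarrow> dist (f x) 0 < d"
      using tendstoD[OF lim d] by (auto simp: eventually_at_infinity)
    have "multi_onorm l (\<lambda>vs. iter_deriv f vs x) \<le> ennreal e" if "R + real l \<le> norm x" for x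
      using small[of R] R that e by (subst multi_onorm_le_iff) (auto simp: less_imp_le)
    then show "\<forall>\<^sub>F x in at_infinity. multi_onorm l (\<lambda>vs. iter_deriv f vs x) \<le> ennreal e"
      by (auto simp: eventually_at_infinity)
  qed
  ultimately show "f \<in> C0_holder n \<beta>"
    by (auto simp: C0_holder_def intro: order.strict_trans1)
qed

end

section \<open>Bochner integrable vector fields\<close>

text \<open>Completeness of Lebesgue measure: cutting off on the exceptional null set gives
  convergence everywhere and changes the limit only on a null set.\<close>

lemma borel_measurable_lebesgue_on_AE_LIMSEQ:
  fixes f :: "nat \<Rightarrow> 'a::euclidean_space \<Rightarrow> 'b::euclidean_space"
  assumes S: "S \<in> sets lebesgue" and f: "\<And>k. f k \<in> borel_measurable (lebesgue_on S)"
    and lim: "AE x in lebesgue_on S. (\<lambda>k. f k x) \<longlonglongrightarrow> g x"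
  shows "g \<in> borel_measurable (lebesgue_on S)"
proof -
  have "AE x in lebesgue. x \<in> S \<longrightarrow> (\<lambda>k. f k x) \<longlonglongrightarrow> g x"
    using lim S by (subst (asm) AE_restrict_space_iff) auto
  then obtain N where N: "N \<in> null_sets lebesgue" "\<And>x. x \<notin> N \<Longrightarrow> x \<in> S \<Longrightarrow> (\<lambda>k. f k x) \<longlonglongrightarrow> g x"
    unfolding completion.AE_iff_null_sets by auto
  have [measurable]: "(\<lambda>x. if x \<in> S then f k x else 0) \<in> borel_measurable lebesgue" for k
    using f borel_measurable_if[OF S] by blast
  have [measurable]: "N \<in> sets lebesgue" using N by auto
  have "(\<lambda>x. indicat_real (- N) x *\<^sub>R (if x \<in> S then g x else 0)) \<in> borel_measurable lebesgue"
  proof (rule borel_measurable_LIMSEQ_metric)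
    have "- N \<in> sets lebesgue"
      using sets.compl_sets[of N lebesgue] N(1) by (simp add: Compl_eq_Diff_UNIV null_setsD2)
    then show "(\<lambda>x. indicat_real (- N) x *\<^sub>R (if x \<in> S then f k x else 0)) \<in> borel_measurable lebesgue" for k
      by (intro borel_measurable_scaleR borel_measurable_indicator) auto
    show "(\<lambda>k. indicat_real (- N) x *\<^sub>R (if x \<in> S then f k x else 0)) \<longlonglongrightarrow>
        indicat_real (- N) x *\<^sub>R (if x \<in> S then g x else 0)" for x
      using N(2)[of x] by (auto simp: indicator_def)
  qed
  moreover have "AE x in lebesgue. indicat_real (- N) x *\<^sub>R (if x \<in> S then g x else 0) = (if x \<in> S then g x else 0)"
    using AE_not_in[OF N(1)] by eventually_elim auto
  ultimately have "(\<lambda>x. if x \<in> S then g x else 0) \<in> borel_measurable lebesgue"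
    by (rule borel_measurable_AE)
  then show ?thesis
    using borel_measurable_if[OF S] by blast
qed

context holder_exponent
begin

text \<open>Exactly what the construction of the flow needs from Bochner integrability of \<open>u\<close>: an integrable
  majorant \<open>m\<close> of the Hoelder norms, and measurability along measurable curves.\<close>

definition vfield :: "nat \<Rightarrow> (real \<Rightarrow> 'a::euclidean_space \<Rightarrow> 'a) \<Rightarrow> (real \<Rightarrow> real) \<Rightarrow> bool" where
  "vfield n u m \<longleftrightarrow> (\<forall>s\<in>{0..1}. holder_bound \<beta> n (m s) (u s)) \<and> m absolutely_integrable_on {0..1} \<and>
    (\<forall>\<phi>. \<phi> \<in> borel_measurable (lebesgue_on {0..1}) \<longrightarrow>
      (\<lambda>s. u s (\<phi> s)) \<in> borel_measurable (lebesgue_on {0..1}))"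

lemma C0_holder_norm:
  assumes "f \<in> C0_holder n \<beta>"
  shows "holder_bound \<beta> n (enn2real (holder_norm n \<beta> f)) f"
  using assms by (subst holder_bound_iff_holder_norm) (auto simp: C0_holder_def infinity_ennreal_def)

lemma holder_bound_holder_norm_le: "holder_bound \<beta> n M f \<Longrightarrow> enn2real (holder_norm n \<beta> f) \<le> M"
  using holder_bound_iff_holder_norm[of M n f] holder_bound_nonneg[of \<beta> n M f] by (auto intro: enn2real_leI)

lemma C0_holder_diff:
  "f \<in> C0_holder n \<beta> \<Longrightarrow> g \<in> C0_holder n \<beta> \<Longrightarrow> (\<lambda>x. f x - g x) \<in> C0_holder n \<beta>"
  using tendsto_diff[of f 0 at_infinity g 0] by (auto simp: C0_holder_iff intro: holder_bound_diff)

text \<open>Used to see that the norms of the approximating simple functions converge to the norm of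
  u t.\<close>

lemma holder_norm_diff_le:
  assumes f: "f \<in> C0_holder n \<beta>" and g: "g \<in> C0_holder n \<beta>"
  shows "\<bar>enn2real (holder_norm n \<beta> f) - enn2real (holder_norm n \<beta> g)\<bar> \<le>
    enn2real (holder_norm n \<beta> (\<lambda>x. f x - g x))"
proof -
  let ?N = "\<lambda>f. enn2real (holder_norm n \<beta> f)"
  note d = C0_holder_norm[OF C0_holder_diff[OF f g]]
  have "?N f \<le> ?N g + ?N (\<lambda>x. f x - g x)"
    using holder_bound_holder_norm_le[OF holder_bound_add[OF C0_holder_norm[OF g] d]] by simp
  moreover have "?N g \<le> ?N f + ?N (\<lambda>x. f x - g x)"
    using holder_bound_holder_norm_le[OF holder_bound_add[OF C0_holder_norm[OF f] holder_bound_uminus[OF d]]] by simp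
  ultimately show ?thesis by linarith
qed

text \<open>A simple function has finitely many values, so its norm is again simple, and along a
  curve \<phi> it is a finite case distinction between continuous maps applied to \<phi>. Both kinds
  of measurability pass to u by almost everywhere limits, since the Hoelder norm dominates pointwise
  distances.\<close>

lemma strongly_measurable_vfield:
  fixes u :: "real \<Rightarrow> 'a::euclidean_space \<Rightarrow> 'a"
  assumes u: "strongly_measurable_C0_holder n \<beta> u" and R: "L1_norm n \<beta> u \<le> ennreal R" "0 \<le> R"
  defines "m \<equiv> \<lambda>s. enn2real (holder_norm n \<beta> (u s))"
  shows "vfield n u m" "integral {0..1} m \<le> R"
proof -
  let ?N = "\<lambda>f. enn2real (holder_norm n \<beta> f)"
  let ?L = "lebesgue_on {0..1::real}"
  have uC: "u t \<in> C0_holder n \<beta>" if "t \<in> {0..1}" for t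
    using u that by (auto simp: strongly_measurable_C0_holder_def)
  obtain s where s: "\<And>k. simple_C0_holder n \<beta> (s k)"
    and lim: "AE t in ?L. (\<lambda>k. holder_norm n \<beta> (\<lambda>x. u t x - s k t x)) \<longlonglongrightarrow> 0"
    using u by (auto simp: strongly_measurable_C0_holder_def)
  have sC: "s k t \<in> C0_holder n \<beta>" if "t \<in> {0..1}" for k t
    using s[of k] that by (auto simp: simple_C0_holder_def)
  have ss: "simple_function ?L (s k)" for k
    using s[of k] by (auto simp: simple_C0_holder_def)
  have "AE t in ?L. t \<in> {0..1}"
    by (intro AE_I2) (simp add: space_restrict_space)
  with lim have limN: "AE t in ?L. t \<in> {0..1} \<and> (\<lambda>k. ?N (\<lambda>x. u t x - s k t x)) \<longlonglongrightarrow> 0"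
    by eventually_elim (use tendsto_enn2real[of _ 0 sequentially] in auto)
  have m: "m \<in> borel_measurable ?L"
  proof (rule borel_measurable_lebesgue_on_AE_LIMSEQ)
    show "(\<lambda>t. ?N (s k t)) \<in> borel_measurable ?L" for k
      using simple_function_compose1[OF ss, of ?N] by (rule borel_measurable_simple_function)
    show "AE t in ?L. (\<lambda>k. ?N (s k t)) \<longlonglongrightarrow> m t"
      using limN
    proof eventually_elim
      case (elim t)
      have "(\<lambda>k. ?N (s k t) - m t) \<longlonglongrightarrow> 0"
      proof (rule Lim_null_comparison)
        show "\<forall>\<^sub>F k in sequentially. norm (?N (s k t) - m t) \<le> ?N (\<lambda>x. u t x - s k t x)"
          using holder_norm_diff_le[OF uC sC] elim by (simp add: m_def abs_minus_commute)
      qed (use elim in auto)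
      then show ?case by (rule LIM_zero_cancel)
    qed
  qed simp
  have meas: "(\<lambda>t. u t (\<phi> t)) \<in> borel_measurable ?L" if \<phi>: "\<phi> \<in> borel_measurable ?L" for \<phi>
  proof (rule borel_measurable_lebesgue_on_AE_LIMSEQ)
    show "(\<lambda>t. s k t (\<phi> t)) \<in> borel_measurable ?L" for k
    proof (rule measurable_compose_countable'[where f = "\<lambda>i t. i (\<phi> t)" and g = "s k" and I = "s k ` space ?L"])
      show "(\<lambda>t. i (\<phi> t)) \<in> borel_measurable ?L" if "i \<in> s k ` space ?L" for i
      proof -
        have "i \<in> C0_holder n \<beta>" using that sC by (auto simp: space_restrict_space)
        then have "continuous_on UNIV i"
          using holder_bound_continuous C0_holder_iff by blast
        then show ?thesis
          using measurable_compose[OF \<phi> borel_measurable_continuous_onI] by blast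
      qed
      show "s k \<in> ?L \<rightarrow>\<^sub>M count_space (s k ` space ?L)"
        using ss[of k] by (subst measurable_count_space_eq2) (auto simp: simple_function_def)
      show "countable (s k ` space ?L)"
        using ss[of k] by (auto simp: simple_function_def intro: countable_finite)
    qed
    show "AE t in ?L. (\<lambda>k. s k t (\<phi> t)) \<longlonglongrightarrow> u t (\<phi> t)"
      using limN
    proof eventually_elim
      case (elim t)
      have "(\<lambda>k. u t (\<phi> t) - s k t (\<phi> t)) \<longlonglongrightarrow> 0"
      proof (rule Lim_null_comparison)
        show "\<forall>\<^sub>F k in sequentially. norm (u t (\<phi> t) - s k t (\<phi> t)) \<le> ?N (\<lambda>x. u t x - s k t x)"
          using holder_bound_norm[OF C0_holder_norm[OF C0_holder_diff[OF uC sC]]] elim by simp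
      qed (use elim in auto)
      from tendsto_diff[OF tendsto_const[of "u t (\<phi> t)"] this] show ?case by simp
    qed
  qed simp
  \<comment> \<open>The norm is finite at every time in [0,1], so the passage to reals by
    \<open>enn2real\<close> loses nothing there.\<close>
  have nn: "(\<integral>\<^sup>+t. ennreal (m t) \<partial>?L) = L1_norm n \<beta> u"
    unfolding L1_norm_def m_def
    using uC by (intro nn_integral_cong) (auto simp: space_restrict_space C0_holder_def infinity_ennreal_def)
  have int: "integrable ?L m"
    using R m nn by (intro integrableI_nonneg) (auto simp: m_def intro: order.strict_trans1)
  then have abs: "m absolutely_integrable_on {0..1}"
    by (simp add: set_integrable_def integrable_restrict_space)
  then show "vfield n u m"
    using meas C0_holder_norm[OF uC] by (auto simp: vfield_def m_def)
  have "integral {0..1} m = integral\<^sup>L ?L m"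
    using lebesgue_integral_eq_integral[OF int] by simp
  also have "\<dots> = enn2real (L1_norm n \<beta> u)"
    using integral_eq_nn_integral[of m ?L] m nn by (auto simp: m_def)
  also have "\<dots> \<le> R"
    using R by (intro enn2real_leI) auto
  finally show "integral {0..1} m \<le> R" .
qed

end

section \<open>Solutions of the flow equation\<close>

context holder_exponent
begin

lemma vfield_holder_bound: "vfield n u m \<Longrightarrow> s \<in> {0..1} \<Longrightarrow> holder_bound \<beta> n (m s) (u s)"
  by (simp add: vfield_def)

lemma vfield_nonneg: "vfield n u m \<Longrightarrow> s \<in> {0..1} \<Longrightarrow> 0 \<le> m s"
  using vfield_holder_bound holder_bound_nonneg by blast

lemma vfield_absolutely_integrable:
  "vfield n u m \<Longrightarrow> 0 \<le> a \<Longrightarrow> b \<le> 1 \<Longrightarrow> m absolutely_integrable_on {a..b}"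
  unfolding vfield_def by (auto intro: set_integrable_subset)

lemma vfield_integrable:
  "vfield n u m \<Longrightarrow> 0 \<le> a \<Longrightarrow> b \<le> 1 \<Longrightarrow> m integrable_on {a..b}"
  using vfield_absolutely_integrable set_lebesgue_integral_eq_integral(1) by blast

lemma vfield_integral_mono:
  assumes "vfield n u m" "0 \<le> a'" "a' \<le> a" "b \<le> b'" "b' \<le> 1"
  shows "integral {a..b} m \<le> integral {a'..b'} m"
  using assms by (intro integral_subset_le vfield_integrable[OF assms(1)])
    (auto intro: vfield_nonneg[OF assms(1)])

lemma vfield_integral_nonneg:
  assumes "vfield n u m" "0 \<le> a" "b \<le> 1"
  shows "0 \<le> integral {a..b} m"
  using assms by (intro integral_nonneg vfield_integrable[OF assms(1)])
    (auto intro: vfield_nonneg[OF assms(1)])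

lemma vfield_compose_absolutely_integrable:
  assumes u: "vfield n u m" and \<phi>: "continuous_on {0..1} \<phi>" and ab: "0 \<le> a" "b \<le> 1"
  shows "(\<lambda>s. u s (\<phi> s)) absolutely_integrable_on {a..b}"
proof -
  have "\<phi> \<in> borel_measurable (lebesgue_on {0..1})"
    using \<phi> by (intro continuous_imp_measurable_on_sets_lebesgue) auto
  then have "(\<lambda>s. u s (\<phi> s)) \<in> borel_measurable (lebesgue_on {0..1})"
    using u by (simp add: vfield_def)
  then have "(\<lambda>s. u s (\<phi> s)) absolutely_integrable_on {0..1}"
    using vfield_integrable[OF u, of 0 1] holder_bound_norm[OF vfield_holder_bound[OF u]]
    by (intro measurable_bounded_by_integrable_imp_absolutely_integrable[where g = m]) auto
  then show ?thesis
    using ab by (auto intro: set_integrable_subset)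
qed

lemma vfield_compose_integrable:
  assumes u: "vfield n u m" and \<phi>: "continuous_on {0..1} \<phi>" and ab: "0 \<le> a" "b \<le> 1"
  shows "(\<lambda>s. u s (\<phi> s)) integrable_on {a..b}"
  using vfield_compose_absolutely_integrable[OF assms] set_lebesgue_integral_eq_integral(1) by blast

text \<open>For a flow, the displacement between the times a and b is such an integral; C will be
  the constant of the composition estimate.\<close>

lemma vfield_integral_holder_bound:
  assumes u: "vfield n u m" and \<Phi>: "\<And>x. continuous_on {0..1} (\<lambda>t. \<Phi> t x)" and ab: "0 \<le> a" "b \<le> 1"
    and C: "\<And>s. s \<in> {0..1} \<Longrightarrow> holder_bound \<beta> n (C * m s) (\<lambda>x. u s (\<Phi> s x))"
  shows "holder_bound \<beta> n (C * integral {a..b} m) (\<lambda>x. integral {a..b} (\<lambda>s. u s (\<Phi> s x)))"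
proof -
  let ?L = "lebesgue_on {a..b}"
  have m: "integrable ?L m"
    using vfield_absolutely_integrable[OF u ab] by (simp add: set_integrable_def integrable_restrict_space)
  note ui = vfield_compose_absolutely_integrable[OF u \<Phi> ab]
  have "integrable ?L (\<lambda>s. u s (\<Phi> s x))" for x
    using ui[of x] by (simp add: set_integrable_def integrable_restrict_space)
  then have eq: "integral\<^sup>L ?L (\<lambda>s. u s (\<Phi> s x)) = integral {a..b} (\<lambda>s. u s (\<Phi> s x))" for x
    by (intro lebesgue_integral_eq_integral) auto
  have "holder_bound \<beta> n (\<integral>s. C * m s \<partial>?L) (\<lambda>x. \<integral>s. u s (\<Phi> s x) \<partial>?L)"
  proof (rule holder_bound_integral)
    show "integrable ?L (\<lambda>s. C * m s)"
      using m by simp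
    show "holder_bound \<beta> n (C * m s) (\<lambda>x. u s (\<Phi> s x))" if "s \<in> space ?L" for s
      using that ab by (intro C) (auto simp: space_restrict_space)
    show "(\<lambda>s. u s (\<Phi> s x)) \<in> borel_measurable ?L" for x
      using absolutely_integrable_imp_borel_measurable[OF ui] by simp
  qed
  then show ?thesis
    using lebesgue_integral_eq_integral[OF m] by (simp add: eq)
qed

text \<open>Since n \<ge> 1, u s is Lipschitz with constant m s. This one estimate drives
  uniqueness, the contraction of the Picard iterates and the passage to the limit in the integral
  equation.\<close>

lemma vfield_integral_diff_le:
  assumes u: "vfield n u m" and n: "n \<ge> 1" and cont: "continuous_on {0..1} \<phi>" "continuous_on {0..1} \<psi>"
    and ab: "0 \<le> a" "b \<le> 1" and D: "\<And>s. s \<in> {a..b} \<Longrightarrow> norm (\<phi> s - \<psi> s) \<le> D"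
  shows "norm (integral {a..b} (\<lambda>s. u s (\<phi> s)) - integral {a..b} (\<lambda>s. u s (\<psi> s))) \<le> D * integral {a..b} m"
proof -
  note i = vfield_compose_integrable[OF u cont(1) ab] vfield_compose_integrable[OF u cont(2) ab]
  have "norm (integral {a..b} (\<lambda>s. u s (\<phi> s) - u s (\<psi> s))) \<le> integral {a..b} (\<lambda>s. D * m s)"
  proof (rule Henstock_Kurzweil_Integration.integral_norm_bound_integral)
    show "(\<lambda>s. D * m s) integrable_on {a..b}"
      using vfield_integrable[OF u ab] by (rule integrable_on_mult_right)
    fix s assume s: "s \<in> {a..b}"
    then have s': "s \<in> {0..1}" using ab by auto
    have "norm (u s (\<phi> s) - u s (\<psi> s)) \<le> m s * norm (\<phi> s - \<psi> s)"
      by (rule holder_bound_Lipschitz[OF vfield_holder_bound[OF u s'] n])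
    also have "\<dots> \<le> m s * D"
      using D[OF s] vfield_nonneg[OF u s'] by (rule mult_left_mono)
    finally show "norm (u s (\<phi> s) - u s (\<psi> s)) \<le> D * m s" by (simp add: mult.commute)
  qed (use i in \<open>intro integrable_diff\<close>)
  then show ?thesis
    using i by (simp add: Henstock_Kurzweil_Integration.integral_diff)
qed

section \<open>Subdivision by mass and uniqueness of solutions\<close>

lemma vfield_split:
  assumes u: "vfield n u m" and T: "0 \<le> T" "T \<le> 1" and AB: "0 \<le> A" "0 \<le> B" "integral {0..T} m \<le> A + B"
  obtains T' where "0 \<le> T'" "T' \<le> T" "integral {0..T'} m \<le> A" "integral {T'..T} m \<le> B"
proof (cases "integral {0..T} m \<le> A")
  case True
  with T AB show ?thesis by (intro that[of T]) auto
next
  case False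
  \<comment> \<open>The mass of {0..t} is continuous in t and exceeds A at T, so it equals A at some
    T'.\<close>
  have "continuous_on {0..T} (\<lambda>t. integral {0..t} m)"
    using vfield_integrable[OF u, of 0 T] T by (intro indefinite_integral_continuous_1) auto
  with False T AB obtain T' where T': "0 \<le> T'" "T' \<le> T" "integral {0..T'} m = A"
    using IVT'[of "\<lambda>t. integral {0..t} m" 0 A T] by auto
  moreover have "integral {0..T'} m + integral {T'..T} m = integral {0..T} m"
    using T T' vfield_integrable[OF u, of 0 T] by (intro Henstock_Kurzweil_Integration.integral_combine) auto
  ultimately show ?thesis using AB by (intro that[of T']) auto
qed

text \<open>In place of a Gronwall argument: the largest distance D between the two curves on the
  interval satisfies D \<le> D / 2.\<close>

lemma solution_unique_short:
  assumes u: "vfield n u m" and n: "n \<ge> 1" and cont: "continuous_on {0..1} \<phi>" "continuous_on {0..1} \<psi>"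
    and ab: "0 \<le> a" "b \<le> 1" and m: "integral {a..b} m \<le> 1/2"
    and eq: "\<And>t. t \<in> {a..b} \<Longrightarrow> \<phi> t = y + integral {a..t} (\<lambda>s. u s (\<phi> s))"
      "\<And>t. t \<in> {a..b} \<Longrightarrow> \<psi> t = y + integral {a..t} (\<lambda>s. u s (\<psi> s))"
    and t: "t \<in> {a..b}"
  shows "\<phi> t = \<psi> t"
proof -
  have "continuous_on {a..b} (\<lambda>t. norm (\<phi> t - \<psi> t))"
    using ab by (intro continuous_intros continuous_on_subset[OF cont(1)] continuous_on_subset[OF cont(2)]) auto
  then obtain t0 where t0: "t0 \<in> {a..b}" "\<And>s. s \<in> {a..b} \<Longrightarrow> norm (\<phi> s - \<psi> s) \<le> norm (\<phi> t0 - \<psi> t0)"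
    using continuous_attains_sup[of "{a..b}" "\<lambda>t. norm (\<phi> t - \<psi> t)"] t by auto
  let ?D = "norm (\<phi> t0 - \<psi> t0)"
  have "?D \<le> ?D * integral {a..t0} m"
    using vfield_integral_diff_le[OF u n cont ab(1), of t0 ?D] t0 ab by (simp add: eq[OF t0(1)])
  also have "\<dots> \<le> ?D * (1/2)"
    using vfield_integral_mono[OF u ab(1) order_refl, of t0 b] t0 ab m by (intro mult_left_mono) auto
  finally have "?D = 0" by simp
  then show ?thesis using t0(2)[OF t] by simp
qed

text \<open>The interval is cut into pieces of mass at most 1/2; agreement up to T' lets both curves
  restart from the same point, and finitely many pieces exhaust the mass of m.\<close>

lemma solution_unique:
  assumes u: "vfield n u m" and n: "n \<ge> 1" and cont: "continuous_on {0..1} \<phi>" "continuous_on {0..1} \<psi>"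
    and eq: "\<And>t. t \<in> {0..1} \<Longrightarrow> \<phi> t = x + integral {0..t} (\<lambda>s. u s (\<phi> s))"
      "\<And>t. t \<in> {0..1} \<Longrightarrow> \<psi> t = x + integral {0..t} (\<lambda>s. u s (\<psi> s))"
    and t: "t \<in> {0..1}"
  shows "\<phi> t = \<psi> t"
proof -
  have "\<forall>T\<in>{0..1}. integral {0..T} m \<le> real k / 2 \<longrightarrow> (\<forall>t\<in>{0..T}. \<phi> t = \<psi> t)" for k
  proof (induction k)
    case 0
    show ?case
    proof (intro ballI impI)
      fix T t assume T: "T \<in> {0..1}" "integral {0..T} m \<le> real 0 / 2" and t: "t \<in> {0..T}"
      show "\<phi> t = \<psi> t"
      proof (rule solution_unique_short[OF u n cont, of 0 T x])
        show "\<phi> t = x + integral {0..t} (\<lambda>s. u s (\<phi> s))" if "t \<in> {0..T}" for t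
          by (rule eq(1)) (use that T in auto)
        show "\<psi> t = x + integral {0..t} (\<lambda>s. u s (\<psi> s))" if "t \<in> {0..T}" for t
          by (rule eq(2)) (use that T in auto)
      qed (use T t in auto)
    qed
  next
    case (Suc k)
    show ?case
    proof (intro ballI impI)
      fix T t assume T: "T \<in> {0..1}" "integral {0..T} m \<le> real (Suc k) / 2" and t: "t \<in> {0..T}"
      then obtain T' where T': "0 \<le> T'" "T' \<le> T" "integral {0..T'} m \<le> real k / 2" "integral {T'..T} m \<le> 1/2"
        using vfield_split[OF u, of T "real k / 2" "1/2"] by (auto simp: field_simps)
      have same: "\<phi> s = \<psi> s" if "s \<in> {0..T'}" for s
        using Suc.IH T' T that by auto
      show "\<phi> t = \<psi> t"
      proof (cases "t \<le> T'")
        case True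
        then show ?thesis using same t by auto
      next
        case False
        have step: "\<theta> t = \<theta> T' + integral {T'..t} (\<lambda>s. u s (\<theta> s))"
          if "t \<in> {T'..T}" and c: "continuous_on {0..1} \<theta>"
            and e: "\<And>t. t \<in> {0..1} \<Longrightarrow> \<theta> t = x + integral {0..t} (\<lambda>s. u s (\<theta> s))" for \<theta> t
        proof -
          have "integral {0..T'} (\<lambda>s. u s (\<theta> s)) + integral {T'..t} (\<lambda>s. u s (\<theta> s)) = integral {0..t} (\<lambda>s. u s (\<theta> s))"
            using that(1) T T' vfield_compose_integrable[OF u c, of 0 t]
            by (intro Henstock_Kurzweil_Integration.integral_combine) auto
          then show ?thesis using e[of t] e[of T'] that(1) T T' by simp
        qed
        show ?thesis
        proof (rule solution_unique_short[OF u n cont, of T' T "\<phi> T'"])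
          show "\<phi> t = \<phi> T' + integral {T'..t} (\<lambda>s. u s (\<phi> s))" if "t \<in> {T'..T}" for t
            using step[OF that cont(1) eq(1)] .
          show "\<psi> t = \<phi> T' + integral {T'..t} (\<lambda>s. u s (\<psi> s))" if "t \<in> {T'..T}" for t
            using step[OF that cont(2) eq(2)] same[of T'] T' by simp
        qed (use T T' t False in auto)
      qed
    qed
  qed
  moreover obtain k :: nat where "2 * integral {0..1} m \<le> real k"
    using real_arch_simple by blast
  ultimately show ?thesis
    using t by (metis (no_types) atLeastAtMost_iff le_divide_eq_numeral1(1) mult.commute order_refl zero_le_one)
qed

section \<open>Picard iteration for small mass\<close>

fun picard :: "(real \<Rightarrow> 'a::euclidean_space \<Rightarrow> 'a) \<Rightarrow> nat \<Rightarrow> real \<Rightarrow> 'a \<Rightarrow> 'a" where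
  "picard u 0 t x = x"
| "picard u (Suc k) t x = x + integral {0..t} (\<lambda>s. u s (picard u k s x))"

text \<open>A working version of \<open>is_flow\<close>: gauge integrals, for ease of calculation
  with indefinite integrals, and continuity in time, which makes u s (\<Phi> s x) measurable in s
  for a \<open>vfield\<close>. Values outside [0,1] are left free; \<open>is_flow_iff_flow\<close>
  relates the two notions.\<close>

definition flow :: "(real \<Rightarrow> 'a::euclidean_space \<Rightarrow> 'a) \<Rightarrow> (real \<Rightarrow> 'a \<Rightarrow> 'a) \<Rightarrow> bool" where
  "flow u \<Phi> \<longleftrightarrow> (\<forall>x. continuous_on {0..1} (\<lambda>t. \<Phi> t x) \<and>
    (\<forall>t\<in>{0..1}. \<Phi> t x = x + integral {0..t} (\<lambda>s. u s (\<Phi> s x))))"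

lemma holder_bound_diff_id_Lipschitz:
  assumes \<Phi>: "holder_bound \<beta> n K (\<lambda>x. \<Phi> x - x)" and n: "n \<ge> 1"
  shows "norm (\<Phi> x - \<Phi> y) \<le> (1 + K) * norm (x - y)"
  using norm_triangle_ineq[of "x - y" "(\<Phi> x - x) - (\<Phi> y - y)"] holder_bound_Lipschitz[OF \<Phi> n, of x y]
  by (simp add: algebra_simps)

text \<open>For n \<ge> 1 the bound K on \<Phi> - Id makes \<Phi> Lipschitz with constant 1 + K,
  which removes the separate Lipschitz hypothesis.\<close>

lemma holder_bound_compose_diffeo:
  assumes n: "n \<ge> 1" and K: "0 \<le> K"
  obtains C where "C \<ge> 1" "\<And>M (f::'a::euclidean_space \<Rightarrow> 'b::real_normed_vector) \<Phi>.
    holder_bound \<beta> n M f \<Longrightarrow> holder_bound \<beta> n K (\<lambda>x. \<Phi> x - x) \<Longrightarrow> holder_bound \<beta> n (C * M) (\<lambda>x. f (\<Phi> x))"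
proof -
  from holder_bound_compose[OF K, of "1 + K" n] K obtain C where C: "C \<ge> 1"
    "\<forall>M (f::'a \<Rightarrow> 'b) \<Phi>. holder_bound \<beta> n M f \<longrightarrow> holder_bound \<beta> n K (\<lambda>x. \<Phi> x - x) \<longrightarrow>
    (\<forall>x y. norm (\<Phi> x - \<Phi> y) \<le> (1 + K) * norm (x - y)) \<longrightarrow> holder_bound \<beta> n (C * M) (\<lambda>x. f (\<Phi> x))"
    by auto
  then show ?thesis
    using holder_bound_diff_id_Lipschitz[OF _ n] by (intro that[of C]) blast+
qed

lemma geometric_increments_bound:
  fixes a :: "nat \<Rightarrow> 'b::real_normed_vector"
  assumes "\<And>k. norm (a (Suc k) - a k) \<le> (1/2) ^ Suc k"
  shows "norm (a (k + j) - a k) \<le> (1/2) ^ k"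
proof -
  have "norm (a (k + j) - a k) \<le> (1/2) ^ k - (1/2) ^ (k + j)"
  proof (induction j)
    case (Suc j)
    have "norm (a (k + Suc j) - a k) \<le> norm (a (Suc (k + j)) - a (k + j)) + norm (a (k + j) - a k)"
      using norm_triangle_ineq[of "a (Suc (k + j)) - a (k + j)" "a (k + j) - a k"] by simp
    also have "\<dots> \<le> (1/2) ^ Suc (k + j) + ((1/2) ^ k - (1/2) ^ (k + j))"
      using assms Suc by (intro add_mono) auto
    finally show ?case by simp
  qed simp
  also have "\<dots> \<le> (1/2) ^ k" by simp
  finally show ?thesis .
qed

lemma geometric_increments_limit:
  fixes a :: "nat \<Rightarrow> 'b::banach"
  assumes a: "\<And>k. norm (a (Suc k) - a k) \<le> (1/2) ^ Suc k"
  shows "a \<longlonglongrightarrow> lim a" "norm (lim a - a k) \<le> (1/2) ^ k"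
proof -
  have "Cauchy a"
  proof (rule metric_CauchyI)
    fix e :: real assume "0 < e"
    then obtain N where N: "(1/2) ^ N < e / 2"
      using real_arch_pow_inv[of "e/2" "1/2"] by auto
    have "dist (a k) (a j) < e" if "k \<ge> N" "j \<ge> N" for k j
      using geometric_increments_bound[OF a, of N "k - N"] geometric_increments_bound[OF a, of N "j - N"] N that
        dist_triangle2[of "a k" "a j" "a N"] by (simp add: dist_norm)
    then show "\<exists>N. \<forall>k\<ge>N. \<forall>j\<ge>N. dist (a k) (a j) < e" by blast
  qed
  then show lim: "a \<longlonglongrightarrow> lim a"
    using Cauchy_convergent convergent_LIMSEQ_iff by blast
  have "(\<lambda>j. a (k + j) - a k) \<longlonglongrightarrow> lim a - a k"
    using LIMSEQ_ignore_initial_segment[OF lim, of k] by (intro tendsto_diff) (auto simp: add.commute)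
  then show "norm (lim a - a k) \<le> (1/2) ^ k"
    by (rule Lim_norm_ubound[rotated]) (use geometric_increments_bound[OF a, of k] in auto)
qed

text \<open>With C the composition constant for radius 1/2, the choice is
  \<open>\<epsilon> = 1 / (2 * C)\<close>: an iterate minus Id is an integral of u along the
  previous iterate and has norm at most C \<epsilon> = 1/2. As C \<ge> 1, the mass itself is at most
  1/2, so the sup distance between successive iterates is halved.\<close>

lemma small_flow_exists:
  assumes n: "n \<ge> 1"
  obtains \<epsilon> where "0 < \<epsilon>"
    "\<And>(u::real \<Rightarrow> 'a::euclidean_space \<Rightarrow> 'a) m. vfield n u m \<Longrightarrow> integral {0..1} m \<le> \<epsilon> \<Longrightarrow>
      \<exists>\<Phi>. flow u \<Phi> \<and> (\<forall>t\<in>{0..1}. holder_bound \<beta> n (1/2) (\<lambda>x. \<Phi> t x - x))"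
proof -
  obtain C where C: "C \<ge> 1" and comp: "\<And>M (f::'a \<Rightarrow> 'a) \<Phi>.
    holder_bound \<beta> n M f \<Longrightarrow> holder_bound \<beta> n (1/2) (\<lambda>x. \<Phi> x - x) \<Longrightarrow> holder_bound \<beta> n (C * M) (\<lambda>x. f (\<Phi> x))"
    using holder_bound_compose_diffeo[OF n, of "1/2"] by auto
  have "\<exists>\<Phi>. flow u \<Phi> \<and> (\<forall>t\<in>{0..1}. holder_bound \<beta> n (1/2) (\<lambda>x. \<Phi> t x - x))"
    if u: "vfield n u m" and small: "integral {0..1} m \<le> 1 / (2 * C)"
    for u :: "real \<Rightarrow> 'a \<Rightarrow> 'a" and m
  proof -
    let ?P = "picard u"
    have Cm: "C * integral {0..t} m \<le> 1/2" if "t \<in> {0..1}" for t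
    proof -
      have "C * integral {0..t} m \<le> C * (1 / (2 * C))"
        using vfield_integral_mono[OF u, of 0 0 t 1] that small C by (intro mult_left_mono) auto
      then show ?thesis using C by simp
    qed
    have m2: "integral {0..t} m \<le> 1/2" if "t \<in> {0..1}" for t
      using Cm[OF that] C vfield_integral_nonneg[OF u, of 0 t] that mult_right_mono[of 1 C "integral {0..t} m"] by auto
    have P: "(\<forall>x. continuous_on {0..1} (\<lambda>t. ?P k t x)) \<and>
        (\<forall>t\<in>{0..1}. holder_bound \<beta> n (1/2) (\<lambda>x. ?P k t x - x))" for k
    proof (induction k)
      case 0
      show ?case
        using holder_bound_mono[OF holder_bound_const[of \<beta> n 0], of "1/2"] by auto
    next
      case (Suc k)
      then have c: "\<And>x. continuous_on {0..1} (\<lambda>t. ?P k t x)" by blast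
      have "holder_bound \<beta> n (C * integral {0..t} m) (\<lambda>x. integral {0..t} (\<lambda>s. u s (?P k s x)))"
        if "t \<in> {0..1}" for t
        using that Suc by (intro vfield_integral_holder_bound[OF u c] comp vfield_holder_bound[OF u]) auto
      then have "holder_bound \<beta> n (1/2) (\<lambda>x. ?P (Suc k) t x - x)" if "t \<in> {0..1}" for t
        using that Cm holder_bound_mono by fastforce
      moreover have "continuous_on {0..1} (\<lambda>t. ?P (Suc k) t x)" for x
        unfolding picard.simps
        by (intro continuous_intros indefinite_integral_continuous_1 vfield_compose_integrable[OF u c]) auto
      ultimately show ?case by blast
    qed
    then have c: "\<And>k x. continuous_on {0..1} (\<lambda>t. ?P k t x)"
      and h: "\<And>k t. t \<in> {0..1} \<Longrightarrow> holder_bound \<beta> n (1/2) (\<lambda>x. ?P k t x - x)" by blast+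
    have incr: "\<forall>t\<in>{0..1}. norm (?P (Suc k) t x - ?P k t x) \<le> (1/2) ^ Suc k" for k x
    proof (induction k)
      case 0
      \<comment> \<open>Iterate 0 is Id, so the first increment is bounded by the radius 1/2 of the
        ball.\<close>
      show ?case using holder_bound_norm[OF h[of _ 1]] by auto
    next
      case (Suc k)
      show ?case
      proof
        fix t :: real assume t: "t \<in> {0..1}"
        have "norm (?P (Suc (Suc k)) t x - ?P (Suc k) t x) =
            norm (integral {0..t} (\<lambda>s. u s (?P (Suc k) s x)) - integral {0..t} (\<lambda>s. u s (?P k s x)))"
          by simp
        also have "\<dots> \<le> (1/2) ^ Suc k * integral {0..t} m"
          by (rule vfield_integral_diff_le[OF u n c c]) (use Suc t in \<open>auto simp del: picard.simps\<close>)
        also have "\<dots> \<le> (1/2) ^ Suc k * (1/2)"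
          using m2[OF t] by (intro mult_left_mono) auto
        finally show "norm (?P (Suc (Suc k)) t x - ?P (Suc k) t x) \<le> (1/2) ^ Suc (Suc k)" by simp
      qed
    qed
    define \<Phi> where "\<Phi> t x = lim (\<lambda>k. ?P k t x)" for t x
    have lim: "(\<lambda>k. ?P k t x) \<longlonglongrightarrow> \<Phi> t x" and err: "norm (\<Phi> t x - ?P k t x) \<le> (1/2) ^ k"
      if "t \<in> {0..1}" for t x k
      unfolding \<Phi>_def using geometric_increments_limit[of "\<lambda>k. ?P k t x"] incr that by blast+
    have half: "(\<lambda>k. (1/2) ^ k :: real) \<longlonglongrightarrow> 0"
      by (rule LIMSEQ_power_zero) simp
    have cont: "continuous_on {0..1} (\<lambda>t. \<Phi> t x)" for x
    proof (rule uniform_limit_theorem)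
      show "\<forall>\<^sub>F k in sequentially. continuous_on {0..1} (\<lambda>t. ?P k t x)" using c by simp
      show "uniform_limit {0..1} (\<lambda>k t. ?P k t x) (\<lambda>t. \<Phi> t x) sequentially"
      proof (rule uniform_limitI)
        fix e :: real assume "0 < e"
        from order_tendstoD(2)[OF half this]
        show "\<forall>\<^sub>F k in sequentially. \<forall>t\<in>{0..1}. dist (?P k t x) (\<Phi> t x) < e"
        proof eventually_elim
          case (elim k)
          show ?case
          proof
            fix t :: real assume "t \<in> {0..1}"
            from err[OF this, of x k] elim show "dist (?P k t x) (\<Phi> t x) < e"
              by (simp add: dist_norm norm_minus_commute)
          qed
        qed
      qed
    qed simp
    have "\<Phi> t x = x + integral {0..t} (\<lambda>s. u s (\<Phi> s x))" if t: "t \<in> {0..1}" for t x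
    proof -
      have "(\<lambda>k. ?P (Suc k) t x - (x + integral {0..t} (\<lambda>s. u s (\<Phi> s x)))) \<longlonglongrightarrow> 0"
      proof (rule Lim_null_comparison)
        show "\<forall>\<^sub>F k in sequentially. norm (?P (Suc k) t x - (x + integral {0..t} (\<lambda>s. u s (\<Phi> s x)))) \<le>
            (1/2) ^ k * integral {0..t} m"
          using vfield_integral_diff_le[OF u n c cont, of 0 t] err t by (simp add: norm_minus_commute)
        show "(\<lambda>k. (1/2) ^ k * integral {0..t} m) \<longlonglongrightarrow> 0"
          using half by (rule tendsto_mult_left_zero)
      qed
      then have "(\<lambda>k. ?P (Suc k) t x) \<longlonglongrightarrow> x + integral {0..t} (\<lambda>s. u s (\<Phi> s x))"
        by (rule LIM_zero_cancel)
      then show ?thesis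
        using LIMSEQ_Suc[OF lim[OF t, of x]] LIMSEQ_unique by blast
    qed
    \<comment> \<open>Only the values of the iterates are known to converge; the bound on
      derivatives comes from closedness of the ball under pointwise limits.\<close>
    moreover have "holder_bound \<beta> n (1/2) (\<lambda>x. \<Phi> t x - x)" if "t \<in> {0..1}" for t
    proof (rule holder_bound_limit)
      show "holder_bound \<beta> n (1/2) (\<lambda>x. ?P k t x - x)" for k
        using h[OF that] .
      show "(\<lambda>k. ?P k t x - x) \<longlonglongrightarrow> \<Phi> t x - x" for x
        by (rule tendsto_diff[OF lim[OF that] tendsto_const])
    qed
    ultimately show ?thesis
      using cont unfolding flow_def by blast
  qed
  then show ?thesis
    using C by (intro that[of "1 / (2 * C)"]) auto
qed

end

section \<open>Composition of flows\<close>

text \<open>Along the path Id + s A with s from 0 to 1 the map stays injective, because |s A v|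
  \<le> |v| / 2. The determinant is continuous in s, never zero and equal to 1 at s = 0, so it
  cannot change sign.\<close>

lemma det_near_identity_pos:
  fixes A :: "real^'n \<Rightarrow> real^'n"
  assumes A: "linear A" and small: "\<And>v. norm (A v) \<le> 1/2 * norm v"
  shows "0 < det (matrix (\<lambda>v. v + A v))"
proof -
  define h where "h s = det (matrix (\<lambda>v. v + s *\<^sub>R A v))" for s
  have nz: "h s \<noteq> 0" if s: "0 \<le> s" "s \<le> 1" for s
  proof -
    have lin: "linear (\<lambda>v. v + s *\<^sub>R A v)"
      using A by (intro linear_compose_add linear_compose_scale_right linear_id[unfolded id_def])
    have "v = 0" if "v + s *\<^sub>R A v = 0" for v
    proof -
      have "norm v = norm (s *\<^sub>R A v)"
        using that by (metis add.commute add.inverse_inverse add_eq_0_iff norm_minus_cancel)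
      also have "\<dots> \<le> 1 * (1/2 * norm v)"
        using mult_mono[OF s(2) small[of v]] s(1) by simp
      finally show ?thesis by simp
    qed
    then have "inj (\<lambda>v. v + s *\<^sub>R A v)"
      using linear_injective_0[OF lin] by blast
    then show ?thesis
      using det_nz_iff_inj[OF lin] by (simp add: h_def)
  qed
  have "continuous_on {0..1} h"
    unfolding h_def det_def matrix_def by (simp, intro continuous_intros)
  moreover have "h 0 = 1"
    by (simp add: h_def matrix_id_mat_1[unfolded id_def])
  ultimately have "0 < h 1"
    using IVT2'[of h 1 0 0] nz by (metis atLeastAtMost_iff less_eq_real_def linorder_not_le order_refl zero_le_one zero_less_one)
  then show ?thesis by (simp add: h_def)
qed

text \<open>Prepares for dominated convergence, which concerns sequences. If the limit fails, it
  fails along points X k of norm at least k.\<close>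

lemma tendsto_at_infinity_sequentiallyI:
  fixes f :: "'a::real_normed_vector \<Rightarrow> 'b::real_normed_vector"
  assumes "\<And>X. filterlim X at_infinity sequentially \<Longrightarrow> (\<lambda>k::nat. f (X k)) \<longlonglongrightarrow> 0"
  shows "(f \<longlongrightarrow> 0) at_infinity"
proof (rule ccontr)
  assume "\<not> (f \<longlongrightarrow> 0) at_infinity"
  then obtain e where e: "0 < e" "\<And>R. \<exists>x. R \<le> norm x \<and> \<not> dist (f x) 0 < e"
    by (auto simp: tendsto_iff eventually_at_infinity)
  have "\<forall>k::nat. \<exists>x. real k \<le> norm x \<and> \<not> dist (f x) 0 < e"
    using e(2) by blast
  from choice[OF this] obtain X where X: "\<And>k::nat. real k \<le> norm (X k) \<and> \<not> dist (f (X k)) 0 < e"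
    by blast
  have "filterlim (\<lambda>k. norm (X k)) at_top sequentially"
    using X by (intro filterlim_at_top_mono[OF filterlim_real_sequentially]) auto
  then have "filterlim X at_infinity sequentially"
    by (rule filterlim_norm_at_top_imp_at_infinity)
  then have "\<forall>\<^sub>F k in sequentially. dist (f (X k)) 0 < e"
    using assms e(1) tendstoD by blast
  then show False using X by auto
qed

section \<open>Gluing flows along a subdivision of time\<close>

context holder_exponent
begin

text \<open>Subintervals are handled by switching u off outside A and not by rescaling time, so the
  pieces remain fields on [0,1] and their flows can be composed directly.\<close>

lemma vfield_restrict:
  assumes u: "vfield n u m" and A: "A \<in> sets lebesgue"
  shows "vfield n (\<lambda>s. if s \<in> A then u s else (\<lambda>_. 0)) (\<lambda>s. if s \<in> A then m s else 0)"
proof -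
  let ?L = "lebesgue_on {0..1::real}"
  have A': "A \<inter> space ?L \<in> sets ?L"
    using A by (auto simp: space_restrict_space sets_restrict_space_iff)
  have "m \<in> borel_measurable ?L"
    using vfield_absolutely_integrable[OF u, of 0 1] by (intro absolutely_integrable_imp_borel_measurable) auto
  then have "(\<lambda>s. if s \<in> A then m s else 0) absolutely_integrable_on {0..1}"
    using vfield_integrable[OF u, of 0 1] vfield_nonneg[OF u] A'
    by (intro measurable_bounded_by_integrable_imp_absolutely_integrable[where g = m] measurable_If_set) auto
  moreover have "(\<lambda>s. (if s \<in> A then u s else (\<lambda>_. 0)) (\<phi> s)) \<in> borel_measurable ?L"
    if "\<phi> \<in> borel_measurable ?L" for \<phi>
  proof -
    have "(\<lambda>s. if s \<in> A then u s (\<phi> s) else 0) \<in> borel_measurable ?L"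
      using u that A' by (intro measurable_If_set) (auto simp: vfield_def)
    moreover have "(\<lambda>s. (if s \<in> A then u s else (\<lambda>_. 0)) (\<phi> s)) = (\<lambda>s. if s \<in> A then u s (\<phi> s) else 0)"
      by auto
    ultimately show ?thesis by simp
  qed
  moreover have "holder_bound \<beta> n 0 (\<lambda>_::'a. 0::'a)"
    using holder_bound_const[of \<beta> n 0] by simp
  ultimately show ?thesis
    using vfield_holder_bound[OF u] unfolding vfield_def by auto
qed

text \<open>\<Phi> stands still after T, and \<Psi> is Id up to T. Hence the composition at time t
  is \<Phi> t before T and \<Psi> t after \<Phi> T from then on, which is the flow of u restarted
  from \<Phi> T.\<close>

lemma flow_glue:
  assumes u: "vfield n u m" and T: "T \<in> {0..1}"
    and \<Phi>: "flow (\<lambda>s. if s \<in> {..T} then u s else (\<lambda>_. 0)) \<Phi>"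
    and \<Psi>: "flow (\<lambda>s. if s \<in> {T..} then u s else (\<lambda>_. 0)) \<Psi>"
  shows "flow u (\<lambda>t x. \<Psi> t (\<Phi> t x))"
proof -
  have r: "integral {0..t} (\<lambda>s. (if s \<in> A then u s else (\<lambda>_. 0)) (\<phi> s)) = integral (A \<inter> {0..t}) (\<lambda>s. u s (\<phi> s))"
    for A t \<phi>
  proof -
    have "(\<lambda>s. (if s \<in> A then u s else (\<lambda>_. 0)) (\<phi> s)) = (\<lambda>s. if s \<in> A then u s (\<phi> s) else 0)"
      by auto
    then show ?thesis by (simp add: integral_restrict_Int)
  qed
  have \<Phi>1: "\<Phi> t x = x + integral {0..t} (\<lambda>s. u s (\<Phi> s x))" if "t \<in> {0..T}" for t x
  proof -
    have "{..T} \<inter> {0..t} = {0..t}" using that by auto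
    then show ?thesis using \<Phi> that T r[of t "{..T}" "\<lambda>s. \<Phi> s x"] unfolding flow_def by auto
  qed
  have \<Phi>2: "\<Phi> t x = \<Phi> T x" if "t \<in> {T..1}" for t x
  proof -
    have "{..T} \<inter> {0..t} = {0..T}" using that by auto
    then have "\<Phi> t x = x + integral {0..T} (\<lambda>s. u s (\<Phi> s x))"
      using \<Phi> that T r[of t "{..T}" "\<lambda>s. \<Phi> s x"] unfolding flow_def by auto
    then show ?thesis using \<Phi>1[of T x] T by simp
  qed
  have \<Psi>1: "\<Psi> t y = y" if "t \<in> {0..T}" for t y
  proof -
    \<comment> \<open>Both cut-off sets contain T; their overlap is a single point and contributes
      nothing to the integral.\<close>
    have "{T..} \<inter> {0..t} = (if t = T then {T} else {})" using that by auto
    then have "integral ({T..} \<inter> {0..t}) (\<lambda>s. u s (\<Psi> s y)) = 0" by simp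
    then show ?thesis using \<Psi> that T r[of t "{T..}" "\<lambda>s. \<Psi> s y"] unfolding flow_def by auto
  qed
  have \<Psi>2: "\<Psi> t y = y + integral {T..t} (\<lambda>s. u s (\<Psi> s y))" if "t \<in> {T..1}" for t y
  proof -
    have "{T..} \<inter> {0..t} = {T..t}" using that T by auto
    then show ?thesis using \<Psi> that T r[of t "{T..}" "\<lambda>s. \<Psi> s y"] unfolding flow_def by auto
  qed
  have cont: "continuous_on {0..1} (\<lambda>t. \<Psi> t (\<Phi> t x))" for x
  proof -
    have "continuous_on {0..T} (\<lambda>t. \<Psi> t (\<Phi> t x)) \<longleftrightarrow> continuous_on {0..T} (\<lambda>t. \<Phi> t x)"
      by (rule continuous_on_cong) (auto simp: \<Psi>1)
    then have 1: "continuous_on {0..T} (\<lambda>t. \<Psi> t (\<Phi> t x))"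
      using \<Phi> T unfolding flow_def by (auto intro: continuous_on_subset)
    have "\<Psi> t (\<Phi> t x) = \<Psi> t (\<Phi> T x)" if "t \<in> {T..1}" for t
      using \<Phi>2[OF that, of x] by simp
    then have "continuous_on {T..1} (\<lambda>t. \<Psi> t (\<Phi> t x)) \<longleftrightarrow> continuous_on {T..1} (\<lambda>t. \<Psi> t (\<Phi> T x))"
      by (intro continuous_on_cong refl)
    then have 2: "continuous_on {T..1} (\<lambda>t. \<Psi> t (\<Phi> t x))"
      using \<Psi> T unfolding flow_def by (auto intro: continuous_on_subset)
    have "{0..1} = {0..T} \<union> {T..1}" using T by auto
    then show ?thesis using continuous_on_closed_Un[OF _ _ 1 2] by simp
  qed
  have early: "\<Psi> t (\<Phi> t x) = x + integral {0..t} (\<lambda>s. u s (\<Psi> s (\<Phi> s x)))" if t: "t \<in> {0..T}" for t x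
  proof -
    have "integral {0..t} (\<lambda>s. u s (\<Psi> s (\<Phi> s x))) = integral {0..t} (\<lambda>s. u s (\<Phi> s x))"
      using t by (intro Henstock_Kurzweil_Integration.integral_cong) (simp add: \<Psi>1)
    then show ?thesis using \<Psi>1[OF t] \<Phi>1[OF t] by simp
  qed
  have "\<Psi> t (\<Phi> t x) = x + integral {0..t} (\<lambda>s. u s (\<Psi> s (\<Phi> s x)))" if t: "t \<in> {T..1}" for t x
  proof -
    have "\<Psi> t (\<Phi> t x) = \<Phi> T x + integral {T..t} (\<lambda>s. u s (\<Psi> s (\<Phi> T x)))"
      using \<Psi>2[OF t] \<Phi>2[OF t] by simp
    also have "integral {T..t} (\<lambda>s. u s (\<Psi> s (\<Phi> T x))) = integral {T..t} (\<lambda>s. u s (\<Psi> s (\<Phi> s x)))"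
    proof (rule Henstock_Kurzweil_Integration.integral_cong)
      fix s assume "s \<in> {T..t}"
      then have "\<Phi> s x = \<Phi> T x" using t by (intro \<Phi>2) auto
      then show "u s (\<Psi> s (\<Phi> T x)) = u s (\<Psi> s (\<Phi> s x))" by simp
    qed
    also have "\<Phi> T x = x + integral {0..T} (\<lambda>s. u s (\<Psi> s (\<Phi> s x)))"
      using early[of T x] \<Psi>1[of T "\<Phi> T x"] T by simp
    finally have "\<Psi> t (\<Phi> t x) = x + (integral {0..T} (\<lambda>s. u s (\<Psi> s (\<Phi> s x))) +
        integral {T..t} (\<lambda>s. u s (\<Psi> s (\<Phi> s x))))"
      by (simp add: add.assoc)
    also have "integral {0..T} (\<lambda>s. u s (\<Psi> s (\<Phi> s x))) + integral {T..t} (\<lambda>s. u s (\<Psi> s (\<Phi> s x))) =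
        integral {0..t} (\<lambda>s. u s (\<Psi> s (\<Phi> s x)))"
      using t T vfield_compose_integrable[OF u cont, of 0 t]
      by (intro Henstock_Kurzweil_Integration.integral_combine) auto
    finally show ?thesis .
  qed
  with early cont show ?thesis
    unfolding flow_def using T by (metis atLeastAtMost_iff linear)
qed

lemma jacobian_near_identity_pos:
  fixes \<Phi> :: "real^'d \<Rightarrow> real^'d"
  assumes \<Phi>: "holder_bound \<beta> n (1/2) (\<lambda>x. \<Phi> x - x)" and n: "n \<ge> 1"
  shows "0 < det (jacobian \<Phi> (at x))"
proof -
  obtain k where k: "n = Suc k" using n by (cases n) auto
  note \<Phi>' = \<Phi>[unfolded k]
  let ?A = "frechet_derivative (\<lambda>x. \<Phi> x - x) (at x)"
  have A: "((\<lambda>x. \<Phi> x - x) has_derivative ?A) (at x)"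
    using holder_bound_has_derivative[OF \<Phi>'] .
  have "(\<Phi> has_derivative (\<lambda>v. v + ?A v)) (at x)"
    using has_derivative_add[OF has_derivative_ident A] by simp
  then have "frechet_derivative \<Phi> (at x) = (\<lambda>v. v + ?A v)"
    by (rule frechet_derivative_at[symmetric])
  moreover have "0 < det (matrix (\<lambda>v. v + ?A v))"
    using holder_bound_norm_frechet_derivative[OF \<Phi>'] has_derivative_linear[OF A]
    by (intro det_near_identity_pos) auto
  ultimately show ?thesis by (simp add: jacobian_def)
qed

lemma holder_bound_diff_id_differentiable:
  assumes "holder_bound \<beta> n K (\<lambda>x. \<Phi> x - x)" "n \<ge> 1"
  shows "\<Phi> differentiable at x"
proof -
  obtain k where "n = Suc k" using assms by (cases n) auto
  then have "(\<lambda>x. (\<Phi> x - x) + x) differentiable at x"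
    using assms by (intro differentiable_add differentiable_ident) auto
  then show ?thesis by simp
qed

lemma det_jacobian_compose:
  fixes \<Phi> \<Psi> :: "real^'d \<Rightarrow> real^'d"
  assumes "\<Phi> differentiable at x" "\<Psi> differentiable at (\<Phi> x)"
  shows "det (jacobian (\<lambda>x. \<Psi> (\<Phi> x)) (at x)) = det (jacobian \<Psi> (at (\<Phi> x))) * det (jacobian \<Phi> (at x))"
proof -
  have "((\<lambda>x. \<Psi> (\<Phi> x)) has_derivative (\<lambda>v. frechet_derivative \<Psi> (at (\<Phi> x)) (frechet_derivative \<Phi> (at x) v))) (at x)"
    using has_derivative_compose[OF assms[unfolded frechet_derivative_works]] .
  then have "frechet_derivative (\<lambda>x. \<Psi> (\<Phi> x)) (at x) = frechet_derivative \<Psi> (at (\<Phi> x)) \<circ> frechet_derivative \<Phi> (at x)"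
    unfolding comp_def by (rule frechet_derivative_at[symmetric])
  then show ?thesis
    using assms by (simp add: jacobian_def matrix_compose linear_frechet_derivative det_mul)
qed

definition diffeo_flow ::
  "nat \<Rightarrow> real \<Rightarrow> (real \<Rightarrow> real^'d \<Rightarrow> real^'d) \<Rightarrow> (real \<Rightarrow> real^'d \<Rightarrow> real^'d) \<Rightarrow> bool" where
  "diffeo_flow n K u \<Phi> \<longleftrightarrow> flow u \<Phi> \<and>
    (\<forall>t\<in>{0..1}. holder_bound \<beta> n K (\<lambda>x. \<Phi> t x - x) \<and> (\<forall>x. 0 < det (jacobian (\<Phi> t) (at x))))"

text \<open>K is chosen before u, which is the uniformity behind the theorem. Let \<Phi> flow
  through k pieces and \<Psi> through the last one. Then \<Psi> \<circ> \<Phi> - Id = (\<Psi> - Id)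
  \<circ> \<Phi> + (\<Phi> - Id) is bounded by C / 2 + K, with C the composition constant for K. The
  Jacobian determinants multiply, and that of \<Psi> is positive because \<Psi> is near Id.\<close>

lemma diffeo_flow_exists_bounded_pieces:
  assumes n: "n \<ge> 1" and \<epsilon>: "0 < \<epsilon>"
    and small: "\<And>(u::real \<Rightarrow> real^'d \<Rightarrow> real^'d) m. vfield n u m \<Longrightarrow> integral {0..1} m \<le> \<epsilon> \<Longrightarrow>
      \<exists>\<Phi>. flow u \<Phi> \<and> (\<forall>t\<in>{0..1}. holder_bound \<beta> n (1/2) (\<lambda>x. \<Phi> t x - x))"
  shows "\<exists>K\<ge>0. \<forall>(u::real \<Rightarrow> real^'d \<Rightarrow> real^'d) m. vfield n u m \<longrightarrow> integral {0..1} m \<le> real k * \<epsilon> \<longrightarrow>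
    (\<exists>\<Phi>. diffeo_flow n K u \<Phi>)"
proof (induction k)
  case 0
  have "\<exists>\<Phi>. diffeo_flow n (1/2) u \<Phi>"
    if u: "vfield n u m" and m: "integral {0..1} m \<le> real 0 * \<epsilon>" for u :: "real \<Rightarrow> real^'d \<Rightarrow> real^'d" and m
  proof -
    have "integral {0..1} m \<le> \<epsilon>" using m \<epsilon> by simp
    from small[OF u this] obtain \<Phi> where \<Phi>: "flow u \<Phi>"
      "\<And>t. t \<in> {0..1} \<Longrightarrow> holder_bound \<beta> n (1/2) (\<lambda>x. \<Phi> t x - x)"
      by blast
    then show ?thesis
      using jacobian_near_identity_pos[OF \<Phi>(2) n] unfolding diffeo_flow_def by blast
  qed
  then show ?case by (intro exI[of _ "1/2"]) auto
next
  case (Suc k)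
  then obtain K where K: "K \<ge> 0" and IH: "\<And>(u::real \<Rightarrow> real^'d \<Rightarrow> real^'d) m. vfield n u m \<Longrightarrow>
      integral {0..1} m \<le> real k * \<epsilon> \<Longrightarrow> \<exists>\<Phi>. diffeo_flow n K u \<Phi>"
    by blast
  obtain C where C: "C \<ge> 1" and comp: "\<And>M (f::real^'d \<Rightarrow> real^'d) \<Phi>.
    holder_bound \<beta> n M f \<Longrightarrow> holder_bound \<beta> n K (\<lambda>x. \<Phi> x - x) \<Longrightarrow> holder_bound \<beta> n (C * M) (\<lambda>x. f (\<Phi> x))"
    by (rule holder_bound_compose_diffeo[OF n K, where 'a = "real^'d" and 'b = "real^'d"]) blast
  have "\<exists>\<Phi>. diffeo_flow n (C * (1/2) + K) u \<Phi>"
    if u: "vfield n u m" and m: "integral {0..1} m \<le> real (Suc k) * \<epsilon>"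
    for u :: "real \<Rightarrow> real^'d \<Rightarrow> real^'d" and m
  proof -
    obtain T where T: "0 \<le> T" "T \<le> 1" "integral {0..T} m \<le> real k * \<epsilon>" "integral {T..1} m \<le> \<epsilon>"
    proof (rule vfield_split[OF u, of 1 "real k * \<epsilon>" \<epsilon>])
      show "integral {0..1} m \<le> real k * \<epsilon> + \<epsilon>" using m by (simp add: algebra_simps)
    qed (use \<epsilon> in auto)
    let ?u1 = "\<lambda>s. if s \<in> {..T} then u s else (\<lambda>_. 0)" and ?u2 = "\<lambda>s. if s \<in> {T..} then u s else (\<lambda>_. 0)"
    have A: "{..T} \<inter> {0..1} = {0..T}" "{T..} \<inter> {0..1} = {T..1}"
      using T by auto
    have i: "integral {0..1} (\<lambda>s. if s \<in> {..T} then m s else 0) = integral {0..T} m"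
      "integral {0..1} (\<lambda>s. if s \<in> {T..} then m s else 0) = integral {T..1} m"
      unfolding integral_restrict_Int A by (rule refl)+
    have "vfield n ?u1 (\<lambda>s. if s \<in> {..T} then m s else 0)"
      by (rule vfield_restrict[OF u]) simp
    from IH[OF this, unfolded i, OF T(3)] obtain \<Phi> where \<Phi>: "diffeo_flow n K ?u1 \<Phi>"
      by blast
    have "vfield n ?u2 (\<lambda>s. if s \<in> {T..} then m s else 0)"
      by (rule vfield_restrict[OF u]) simp
    from small[OF this, unfolded i, OF T(4)] obtain \<Psi> where \<Psi>: "flow ?u2 \<Psi>"
      "\<And>t. t \<in> {0..1} \<Longrightarrow> holder_bound \<beta> n (1/2) (\<lambda>x. \<Psi> t x - x)"
      by blast
    have "flow u (\<lambda>t x. \<Psi> t (\<Phi> t x))"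
      using \<Phi> T by (intro flow_glue[OF u _ _ \<Psi>(1)]) (auto simp: diffeo_flow_def)
    moreover have "holder_bound \<beta> n (C * (1/2) + K) (\<lambda>x. \<Psi> t (\<Phi> t x) - x) \<and>
        (\<forall>x. 0 < det (jacobian (\<lambda>x. \<Psi> t (\<Phi> t x)) (at x)))" if t: "t \<in> {0..1}" for t
    proof (intro conjI allI)
      have h: "holder_bound \<beta> n K (\<lambda>x. \<Phi> t x - x)" and pos: "0 < det (jacobian (\<Phi> t) (at x))" for x
        using \<Phi> t unfolding diffeo_flow_def by blast+
      show "holder_bound \<beta> n (C * (1/2) + K) (\<lambda>x. \<Psi> t (\<Phi> t x) - x)"
        using holder_bound_add[OF comp[OF \<Psi>(2)[OF t] h] h] by simp
      show "0 < det (jacobian (\<lambda>x. \<Psi> t (\<Phi> t x)) (at x))" for x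
        using det_jacobian_compose[OF holder_bound_diff_id_differentiable[OF h n, of x]
            holder_bound_diff_id_differentiable[OF \<Psi>(2)[OF t] n]]
          pos[of x] jacobian_near_identity_pos[OF \<Psi>(2)[OF t] n] by simp
    qed
    ultimately show ?thesis unfolding diffeo_flow_def by blast
  qed
  then show ?case using K C by (intro exI[of _ "C * (1/2) + K"]) auto
qed

lemma diffeo_flow_exists:
  assumes n: "n \<ge> 1"
  obtains K where "K \<ge> 0" "\<And>(u::real \<Rightarrow> real^'d \<Rightarrow> real^'d) m. vfield n u m \<Longrightarrow> integral {0..1} m \<le> R \<Longrightarrow>
    \<exists>\<Phi>. diffeo_flow n K u \<Phi>"
proof -
  obtain \<epsilon> where \<epsilon>: "0 < \<epsilon>" and small: "\<And>(u::real \<Rightarrow> real^'d \<Rightarrow> real^'d) m. vfield n u m \<Longrightarrow> integral {0..1} m \<le> \<epsilon> \<Longrightarrow>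
      \<exists>\<Phi>. flow u \<Phi> \<and> (\<forall>t\<in>{0..1}. holder_bound \<beta> n (1/2) (\<lambda>x. \<Phi> t x - x))"
    by (rule small_flow_exists[OF n, where 'a = "real^'d"]) blast
  obtain k where "R / \<epsilon> \<le> real k"
    using real_arch_simple by blast
  then have k: "R \<le> real k * \<epsilon>"
    using \<epsilon> by (simp add: field_simps)
  have "\<exists>K\<ge>0. \<forall>(u::real \<Rightarrow> real^'d \<Rightarrow> real^'d) m. vfield n u m \<longrightarrow> integral {0..1} m \<le> real k * \<epsilon> \<longrightarrow>
      (\<exists>\<Phi>. diffeo_flow n K u \<Phi>)"
    using small by (rule diffeo_flow_exists_bounded_pieces[OF n \<epsilon>])
  then obtain K where K: "K \<ge> 0"
    "\<And>(u::real \<Rightarrow> real^'d \<Rightarrow> real^'d) m. vfield n u m \<Longrightarrow> integral {0..1} m \<le> real k * \<epsilon> \<Longrightarrow> \<exists>\<Phi>. diffeo_flow n K u \<Phi>"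
    by blast
  show ?thesis
    by (rule that[OF K(1)], rule K(2)) (use k in auto)
qed

section \<open>Decay at infinity and continuity in time\<close>

lemma flow_tendsto_id:
  assumes u: "vfield n u m" and van: "\<And>s. s \<in> {0..1} \<Longrightarrow> (u s \<longlongrightarrow> 0) at_infinity"
    and \<Phi>: "flow u \<Phi>" and K: "\<And>s x. s \<in> {0..1} \<Longrightarrow> norm (\<Phi> s x - x) \<le> K" and t: "t \<in> {0..1}"
  shows "((\<lambda>x. \<Phi> t x - x) \<longlongrightarrow> 0) at_infinity"
proof (rule tendsto_at_infinity_sequentiallyI)
  fix X :: "nat \<Rightarrow> 'a" assume X: "filterlim X at_infinity sequentially"
  have cont: "continuous_on {0..1} (\<lambda>t. \<Phi> t x)" and eq: "\<Phi> t x = x + integral {0..t} (\<lambda>s. u s (\<Phi> s x))" for x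
    using \<Phi> t unfolding flow_def by blast+
  \<comment> \<open>\<Phi> s moves points by at most K, so points that tend to infinity are carried
    to points that tend to infinity. Hence the integrand tends to 0 at every time s, with majorant
    m.\<close>
  have X': "filterlim (\<lambda>k. \<Phi> s (X k)) at_infinity sequentially" if s: "s \<in> {0..1}" for s
  proof (rule filterlim_norm_at_top_imp_at_infinity, rule filterlim_at_top_mono)
    have "filterlim (\<lambda>k. norm (X k)) at_top sequentially"
      using filterlim_compose[OF filterlim_norm_at_top X] .
    then show "filterlim (\<lambda>k. - K + norm (X k)) at_top sequentially"
      by (rule filterlim_tendsto_add_at_top[OF tendsto_const])
    have "- K + norm (X k) \<le> norm (\<Phi> s (X k))" for k
      using K[OF s, of "X k"] norm_triangle_sub[of "X k" "\<Phi> s (X k)"] by (simp add: norm_minus_commute)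
    then show "\<forall>\<^sub>F k in sequentially. - K + norm (X k) \<le> norm (\<Phi> s (X k))" by simp
  qed
  have "(\<lambda>k. integral {0..t} (\<lambda>s. u s (\<Phi> s (X k)))) \<longlonglongrightarrow> integral {0..t} (\<lambda>s. 0)"
  proof (rule dominated_convergence)
    show "(\<lambda>s. u s (\<Phi> s (X k))) integrable_on {0..t}" for k
      using t by (intro vfield_compose_integrable[OF u cont]) auto
    show "m integrable_on {0..t}"
      using t by (intro vfield_integrable[OF u]) auto
    show "norm (u s (\<Phi> s (X k))) \<le> m s" if "s \<in> {0..t}" for k s
      using that t by (intro holder_bound_norm[OF vfield_holder_bound[OF u]]) auto
    show "(\<lambda>k. u s (\<Phi> s (X k))) \<longlonglongrightarrow> 0" if "s \<in> {0..t}" for s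
      using that t by (intro filterlim_compose[OF van X']) auto
  qed
  then show "(\<lambda>k. \<Phi> t (X k) - X k) \<longlonglongrightarrow> 0"
    by (subst eq) simp
qed

lemma flow_holder_continuous:
  assumes u: "vfield n u m" and n: "n \<ge> 1" and \<Phi>: "flow u \<Phi>"
    and K: "\<And>s. s \<in> {0..1} \<Longrightarrow> holder_bound \<beta> n K (\<lambda>x. \<Phi> s x - x)" and t: "t \<in> {0..1}"
  shows "((\<lambda>s. holder_norm n \<beta> (\<lambda>x. \<Phi> s x - \<Phi> t x)) \<longlongrightarrow> 0) (at t within {0..1})"
proof (rule ennreal_tendsto_zeroI)
  fix e :: real assume e: "0 < e"
  have cont: "continuous_on {0..1} (\<lambda>t. \<Phi> t x)" for x
    using \<Phi> unfolding flow_def by blast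
  have eq: "\<Phi> t x = x + integral {0..t} (\<lambda>s. u s (\<Phi> s x))" if "t \<in> {0..1}" for x t
    using \<Phi> that unfolding flow_def by blast
  have "0 \<le> K" using holder_bound_nonneg[OF K[OF t]] .
  \<comment> \<open>K bounds \<Phi> s - Id at all times s, so one constant C serves every
    increment.\<close>
  then obtain C where C: "C \<ge> 1" and comp: "\<And>M (f::'a \<Rightarrow> 'a) \<Phi>.
    holder_bound \<beta> n M f \<Longrightarrow> holder_bound \<beta> n K (\<lambda>x. \<Phi> x - x) \<Longrightarrow> holder_bound \<beta> n (C * M) (\<lambda>x. f (\<Phi> x))"
    by (rule holder_bound_compose_diffeo[OF n, where 'a = 'a and 'b = 'a]) blast
  let ?I = "\<lambda>t. integral {0..t} m"
  have incr: "holder_bound \<beta> n (C * (?I b - ?I a)) (\<lambda>x. \<Phi> b x - \<Phi> a x)"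
    if ab: "0 \<le> a" "a \<le> b" "b \<le> 1" for a b
  proof -
    have "?I a + integral {a..b} m = ?I b"
      using ab vfield_integrable[OF u, of 0 b] by (intro Henstock_Kurzweil_Integration.integral_combine) auto
    then have I: "?I b - ?I a = integral {a..b} m"
      by simp
    have "integral {0..a} (\<lambda>s. u s (\<Phi> s x)) + integral {a..b} (\<lambda>s. u s (\<Phi> s x)) =
        integral {0..b} (\<lambda>s. u s (\<Phi> s x))" for x
      using ab vfield_compose_integrable[OF u cont, of 0 b]
      by (intro Henstock_Kurzweil_Integration.integral_combine) auto
    then have \<Phi>I: "\<Phi> b x - \<Phi> a x = integral {a..b} (\<lambda>s. u s (\<Phi> s x))" for x
      using eq[of a x] eq[of b x] ab by (simp add: algebra_simps)
    show ?thesis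
      unfolding I \<Phi>I
      using ab by (intro vfield_integral_holder_bound[OF u cont] comp[OF vfield_holder_bound[OF u] K]) auto
  qed
  \<comment> \<open>The primitive of m is nondecreasing, so the absolute value covers both orders of
    s and t.\<close>
  have bound: "holder_bound \<beta> n (C * \<bar>?I s - ?I t\<bar>) (\<lambda>x. \<Phi> s x - \<Phi> t x)" if s: "s \<in> {0..1}" for s
  proof (cases "t \<le> s")
    case True
    then show ?thesis
      using incr[of t s] s t vfield_integral_mono[OF u, of 0 0 t s] by simp
  next
    case False
    then show ?thesis
      using holder_bound_uminus[OF incr[of s t]] s t vfield_integral_mono[OF u, of 0 0 s t] by simp
  qed
  have "continuous_on {0..1} ?I"
    by (intro indefinite_integral_continuous_1 vfield_integrable[OF u]) auto
  then have "(?I \<longlongrightarrow> ?I t) (at t within {0..1})"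
    using t by (simp add: continuous_on_def)
  moreover have "0 < e / C" using e C by simp
  ultimately have "\<forall>\<^sub>F s in at t within {0..1}. dist (?I s) (?I t) < e / C"
    by (rule tendstoD)
  moreover have "\<forall>\<^sub>F s in at t within {0..1}. s \<in> {0..1}"
    by (simp add: eventually_at_filter)
  ultimately show "\<forall>\<^sub>F s in at t within {0..1}. holder_norm n \<beta> (\<lambda>x. \<Phi> s x - \<Phi> t x) \<le> ennreal e"
  proof eventually_elim
    case (elim s)
    then have "C * \<bar>?I s - ?I t\<bar> \<le> e"
      using C by (simp add: dist_real_def field_simps)
    from holder_bound_mono[OF bound[OF elim(2)] this] show ?case
      using e by (simp add: holder_bound_iff_holder_norm)
  qed
qed

section \<open>Identification with the flow map\<close>

lemma flow_cong:
  assumes "flow u \<Phi>" "\<And>t. t \<in> {0..1} \<Longrightarrow> \<Psi> t = \<Phi> t"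
  shows "flow u \<Psi>"
  unfolding flow_def
proof (intro allI conjI ballI)
  fix x
  have "continuous_on {0..1} (\<lambda>t. \<Psi> t x) \<longleftrightarrow> continuous_on {0..1} (\<lambda>t. \<Phi> t x)"
    using assms(2) by (intro continuous_on_cong) auto
  then show "continuous_on {0..1} (\<lambda>t. \<Psi> t x)"
    using assms(1) by (simp add: flow_def)
  fix t :: real assume t: "t \<in> {0..1}"
  have "integral {0..t} (\<lambda>s. u s (\<Psi> s x)) = integral {0..t} (\<lambda>s. u s (\<Phi> s x))"
    using assms(2) t by (intro Henstock_Kurzweil_Integration.integral_cong) auto
  then show "\<Psi> t x = x + integral {0..t} (\<lambda>s. u s (\<Psi> s x))"
    using assms t unfolding flow_def by metis
qed

text \<open>Continuity in time is automatic on the left, the solution being an indefinite integral.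
  Conversely, continuity makes the integrand measurable with majorant m, hence absolutely
  integrable, and then Lebesgue and gauge integrals agree.\<close>

lemma is_flow_iff_flow:
  assumes u: "vfield n u m"
  shows "is_flow u \<Phi> \<longleftrightarrow> \<Phi> \<in> extensional {0..1} \<and> flow u \<Phi>"
proof
  assume \<Phi>: "is_flow u \<Phi>"
  have ai: "(\<lambda>s. u s (\<Phi> s x)) absolutely_integrable_on {0..t}" if "t \<le> 1" for x t
    using \<Phi> that by (auto simp: is_flow_def intro: set_integrable_subset)
  have eq: "\<Phi> t x = x + integral {0..t} (\<lambda>s. u s (\<Phi> s x))" if "t \<in> {0..1}" for t x
    using \<Phi> that set_lebesgue_integral_eq_integral(2)[OF ai[of t x]] by (simp add: is_flow_def)
  have "continuous_on {0..1} (\<lambda>t. \<Phi> t x)" for x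
  proof -
    have "continuous_on {0..1} (\<lambda>t. \<Phi> t x) \<longleftrightarrow>
        continuous_on {0..1} (\<lambda>t. x + integral {0..t} (\<lambda>s. u s (\<Phi> s x)))"
      by (rule continuous_on_cong[OF refl eq])
    moreover have "continuous_on {0..1} (\<lambda>t. x + integral {0..t} (\<lambda>s. u s (\<Phi> s x)))"
      using set_lebesgue_integral_eq_integral(1)[OF ai[of 1 x]]
      by (intro continuous_intros indefinite_integral_continuous_1) auto
    ultimately show ?thesis by (rule iffD2)
  qed
  with eq \<Phi> show "\<Phi> \<in> extensional {0..1} \<and> flow u \<Phi>"
    unfolding flow_def is_flow_def by blast
next
  assume \<Phi>: "\<Phi> \<in> extensional {0..1} \<and> flow u \<Phi>"
  then have cont: "continuous_on {0..1} (\<lambda>t. \<Phi> t x)" for x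
    by (simp add: flow_def)
  have "(LINT s:{0..t}|lebesgue. u s (\<Phi> s x)) = integral {0..t} (\<lambda>s. u s (\<Phi> s x))" if "t \<in> {0..1}" for t x
    using that by (intro set_lebesgue_integral_eq_integral(2) vfield_compose_absolutely_integrable[OF u cont]) auto
  moreover have "set_integrable lebesgue {0..1} (\<lambda>s. u s (\<Phi> s x))" for x
    by (rule vfield_compose_absolutely_integrable[OF u cont]) auto
  ultimately show "is_flow u \<Phi>"
    using \<Phi> by (simp add: is_flow_def flow_def)
qed

text \<open>Uniqueness for each starting point, together with extensionality in time, gives the
  definite description in \<open>flow_map\<close> its value.\<close>

lemma flow_map_eq_restrict:
  assumes u: "vfield n u m" and n: "n \<ge> 1" and \<Phi>: "flow u \<Phi>"
  shows "flow_map u = restrict \<Phi> {0..1}"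
  unfolding flow_map_def
proof (rule the_equality)
  show "is_flow u (restrict \<Phi> {0..1})"
    unfolding is_flow_iff_flow[OF u] using flow_cong[OF \<Phi>] by auto
  fix \<Psi> assume "is_flow u \<Psi>"
  then have \<Psi>: "\<Psi> \<in> extensional {0..1}" "flow u \<Psi>"
    unfolding is_flow_iff_flow[OF u] by auto
  have "\<Psi> t x = \<Phi> t x" if "t \<in> {0..1}" for t x
  proof (rule solution_unique[OF u n _ _ _ _ that])
    show "continuous_on {0..1} (\<lambda>t. \<Psi> t x)" "continuous_on {0..1} (\<lambda>t. \<Phi> t x)"
      using \<Phi> \<Psi> by (auto simp: flow_def)
    show "\<Psi> t x = x + integral {0..t} (\<lambda>s. u s (\<Psi> s x))" "\<Phi> t x = x + integral {0..t} (\<lambda>s. u s (\<Phi> s x))"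
      if "t \<in> {0..1}" for t
      using \<Phi> \<Psi> that unfolding flow_def by blast+
  qed
  then show "\<Psi> = restrict \<Phi> {0..1}"
    using \<Psi>(1) by (intro extensionalityI[of _ "{0..1}"]) auto
qed

lemma bounded_flow_map:
  fixes B :: "(real \<Rightarrow> real^'d \<Rightarrow> real^'d) set"
  assumes n: "n \<ge> 1" and B: "bounded_L1 n \<beta> B"
  shows "bounded_C_diffeo n \<beta> (flow_map ` B)"
proof -
  obtain R0 :: real where BL: "B \<subseteq> L1_C0_holder n \<beta>" and R0: "\<And>u. u \<in> B \<Longrightarrow> L1_norm n \<beta> u \<le> ennreal R0"
    using B by (auto simp: bounded_L1_def)
  \<comment> \<open>R0 may be negative, in which case \<open>ennreal R0\<close> is 0; R is
    nonnegative and bounds the same norms.\<close>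
  define R where "R = max R0 0"
  have R: "L1_norm n \<beta> u \<le> ennreal R" if "u \<in> B" for u
    using R0[OF that] by (auto simp: R_def intro: order_trans ennreal_leI)
  obtain K where K: "K \<ge> 0" and ex: "\<And>(u::real \<Rightarrow> real^'d \<Rightarrow> real^'d) m. vfield n u m \<Longrightarrow> integral {0..1} m \<le> R \<Longrightarrow>
      \<exists>\<Phi>. diffeo_flow n K u \<Phi>"
    by (rule diffeo_flow_exists[OF n, where R = R and 'd = 'd]) blast
  have "flow_map u \<in> C_diffeo_holder n \<beta> \<and> sup_norm_minus_id n \<beta> (flow_map u) \<le> ennreal K" if uB: "u \<in> B" for u
  proof -
    let ?m = "\<lambda>s. enn2real (holder_norm n \<beta> (u s))"
    have sm: "strongly_measurable_C0_holder n \<beta> u"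
      using uB BL by (auto simp: L1_C0_holder_def)
    have u: "vfield n u ?m" and m: "integral {0..1} ?m \<le> R"
      using strongly_measurable_vfield[OF sm R[OF uB]] by (auto simp: R_def)
    from ex[OF u m] obtain \<Phi> where "diffeo_flow n K u \<Phi>" by blast
    then have \<Phi>: "flow u \<Phi>" and h: "\<And>t. t \<in> {0..1} \<Longrightarrow> holder_bound \<beta> n K (\<lambda>x. \<Phi> t x - x)"
      and pos: "\<And>t x. t \<in> {0..1} \<Longrightarrow> 0 < det (jacobian (\<Phi> t) (at x))"
      unfolding diffeo_flow_def by blast+
    have fm: "flow_map u = restrict \<Phi> {0..1}"
      by (rule flow_map_eq_restrict[OF u n \<Phi>])
    have van: "(u s \<longlongrightarrow> 0) at_infinity" if "s \<in> {0..1}" for s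
      using sm that C0_holder_iff unfolding strongly_measurable_C0_holder_def by blast
    have "\<Phi> t \<in> diffeo_holder n \<beta>" if t: "t \<in> {0..1}" for t
      unfolding diffeo_holder_def C0_holder_iff
      using h[OF t] pos[OF t] flow_tendsto_id[OF u van \<Phi> holder_bound_norm[OF h] t] by blast
    moreover have "((\<lambda>s. holder_norm n \<beta> (\<lambda>x. restrict \<Phi> {0..1} s x - restrict \<Phi> {0..1} t x)) \<longlongrightarrow> 0) (at t within {0..1})"
      if t: "t \<in> {0..1}" for t
    proof (rule Lim_transform_within[OF flow_holder_continuous[OF u n \<Phi> h t], of 1])
      show "holder_norm n \<beta> (\<lambda>x. \<Phi> s x - \<Phi> t x) = holder_norm n \<beta> (\<lambda>x. restrict \<Phi> {0..1} s x - restrict \<Phi> {0..1} t x)"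
        if "s \<in> {0..1}" for s
        using that t by simp
    qed auto
    ultimately have "flow_map u \<in> C_diffeo_holder n \<beta>"
      unfolding fm C_diffeo_holder_def by auto
    moreover have "sup_norm_minus_id n \<beta> (flow_map u) \<le> ennreal K"
      unfolding fm sup_norm_minus_id_def
    proof (rule SUP_least)
      fix t :: real assume "t \<in> {0..1}"
      then show "holder_norm n \<beta> (\<lambda>x. restrict \<Phi> {0..1} t x - x) \<le> ennreal K"
        using h[of t] by (simp add: holder_bound_iff_holder_norm[OF K])
    qed
    ultimately show ?thesis by blast
  qed
  then show ?thesis
    unfolding bounded_C_diffeo_def by blast
qed

end

theorem proposition5p5:
  fixes n :: nat and \<beta> :: real
  assumes "n \<ge> 1" and "0 < \<beta>" and "\<beta> \<le> 1"
  shows "\<forall>B :: (real \<Rightarrow> real^'d \<Rightarrow> real^'d) set.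
           bounded_L1 n \<beta> B \<longrightarrow> bounded_C_diffeo n \<beta> (flow_map ` B)"
proof -
  interpret holder_exponent \<beta>
    using assms by unfold_locales
  show ?thesis
    using bounded_flow_map[OF assms(1)] by blast
qed

end
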